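(* Let $\alpha\ge0$ and consider the bivariate mean-field equation on $\mathcal P_{\rm sym}(\{0,1\}^2)$ $$\tfrac{\partial}{\partial t}\mu^{(2)}_t=\alpha\{T_{\mathtt{cob}^{(2)}}(\mu^{(2)}_t)-\mu^{(2)}_t\}+\{T_{\mathtt{dth}^{(2)}}(\mu^{(2)}_t)-\mu^{(2)}_t\}\qquad(t\ge0),$$ with notation as in the context. For $\alpha>4$ this equation has precisely four fixed points in $\mathcal P_{\rm sym}(\{0,1\}^2)$, denoted $$\overline\nu^{(2)}_{\rm low},\quad\underline\nu^{(2)}_{\rm mid},\quad\overline\nu^{(2)}_{\rm mid},\quad\overline\nu^{(2)}_{\rm upp},$$ which are uniquely characterized by their respective one-dimensional marginals $\nu_{\rm low},\nu_{\rm mid},\nu_{\rm mid},\nu_{\rm upp}$, as well as the fact that $\overline\nu^{(2)}_{\rm low},\overline\nu^{(2)}_{\rm mid},\overline\nu^{(2)}_{\rm upp}$ are concentrated on the diagonal $\{(0,0),(1,1)\}$, but $\underline\nu^{(2)}_{\rm mid}$ is not. For any $\mu^{(2)}_0\in\mathcal P_{\rm sym}(\{0,1\}^2)$, the solution started in $\mu^{(2)}_0$ converges as $t\to\infty$ to one of these fixed points, the respective domains of attraction being $$\{\mu^{(2)}_0:\mu^{(1)}_0(\{1\})<z_{\rm mid}\},\quad\{\mu^{(2)}_0:\mu^{(1)}_0(\{1\})=z_{\rm mid},\ \mu^{(2)}_0\ne\overline\nu^{(2)}_{\rm mid}\},\quad\{\overline\nu^{(2)}_{\rm mid}\},\quad\{\mu^{(2)}_0:\mu^{(1)}_0(\{1\})>z_{\rm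 mid}\}.$$ For $\alpha=4$, there are two fixed points $\overline\nu^{(2)}_{\rm low}$ and $\overline\nu^{(2)}_{\rm upp}$, with respective domains of attraction $$\{\mu^{(2)}_0:\mu^{(1)}_0(\{1\})<z_{\rm mid}\}\quad\text{and}\quad\{\mu^{(2)}_0:\mu^{(1)}_0(\{1\})\ge z_{\rm mid}\},$$ while for $\alpha<4$ all solutions converge to $\overline\nu^{(2)}_{\rm low}$.
   Context: $\mathcal P_{\rm sym}(\{0,1\}^2)$ is the set of probability measures on $\{0,1\}^2$ that are invariant under exchange of the two coordinates; for such $\mu^{(2)}$, $\mu^{(1)}$ denotes its (common) one-dimensional marginal. $\mathtt{cob}(x_1,x_2,x_3):=x_1\vee(x_2\wedge x_3)$ on $\{0,1\}^3$ and $\mathtt{dth}:\{0,1\}^0\to\{0,1\}$ is the constant $0$. For $g:\{0,1\}^k\to\{0,1\}$, $g^{(2)}:(\{0,1\}^2)^k\to\{0,1\}^2$ is defined by $g^{(2)}((x^1_1,x^2_1),\ldots,(x^1_k,x^2_k)):=(g(x^1_1,\ldots,x^1_k),g(x^2_1,\ldots,x^2_k))$, and $T_{g^{(2)}}(\mu^{(2)})$ is the law of $g^{(2)}(Y_1,\ldots,Y_k)$ with $Y_1,\ldots,Y_k$ i.i.d. with law $\mu^{(2)}$. $z_{\rm low}:=0$ and, for $\alpha\ge4$, $z_{\rm mid}:=\frac12-\sqrt{\frac14-\frac1\alpha}$ and $z_{\rm upp}:=\frac12+\sqrt{\frac14-\frac1\alpha}$; $\nu_{\ldots}$ is the probability measure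 on $\{0,1\}$ with $\nu_{\ldots}(\{1\})=z_{\ldots}$. For a probability measure $\nu$ on $\{0,1\}$, $\overline\nu^{(2)}$ denotes the law of $(X,X)$ where $X$ has law $\nu$. *)

theory Defs
  imports "HOL-Probability.Probability"
begin

text \<open>
  The set $\{0,1\}$ is the type \<^typ>\<open>bool\<close>, with $1$ read as \<^term>\<open>True\<close>. A map
  $g : \{0,1\}^k \to \{0,1\}$ is a function on lists, together with its arity $k$; only its values
  on lists of length $k$ matter.
\<close>

definition cob :: "bool list \<Rightarrow> bool" where
  "cob xs \<longleftrightarrow> xs ! 0 \<or> (xs ! 1 \<and> xs ! 2)"

definition dth :: "bool list \<Rightarrow> bool" where
  "dth xs \<longleftrightarrow> False"

definition bivariate :: "(bool list \<Rightarrow> bool) \<Rightarrow> (bool \<times> bool) list \<Rightarrow> bool \<times> bool" where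
  "bivariate g ys = (g (map fst ys), g (map snd ys))"

definition T_op :: "nat \<Rightarrow> ('a list \<Rightarrow> 'a) \<Rightarrow> 'a pmf \<Rightarrow> 'a pmf" where
  "T_op k g \<mu> = map_pmf g (replicate_pmf k \<mu>)"

definition P_sym :: "(bool \<times> bool) pmf set" where
  "P_sym = {\<mu>. map_pmf prod.swap \<mu> = \<mu>}"

definition marginal :: "(bool \<times> bool) pmf \<Rightarrow> bool pmf" where
  "marginal \<mu> = map_pmf fst \<mu>"

definition diag_law :: "bool pmf \<Rightarrow> (bool \<times> bool) pmf" where
  "diag_law \<nu> = map_pmf (\<lambda>x. (x, x)) \<nu>"

definition on_diagonal :: "(bool \<times> bool) pmf \<Rightarrow> bool" where
  "on_diagonal \<mu> \<longleftrightarrow> measure_pmf.prob \<mu> {(False, False), (True, True)} = 1"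

definition mf_rhs :: "real \<Rightarrow> (bool \<times> bool) pmf \<Rightarrow> bool \<times> bool \<Rightarrow> real" where
  "mf_rhs \<alpha> \<mu> x =
     \<alpha> * (pmf (T_op 3 (bivariate cob) \<mu>) x - pmf \<mu> x)
     + (pmf (T_op 0 (bivariate dth) \<mu>) x - pmf \<mu> x)"

text \<open>
  Since $\{0,1\}^2$ is finite, differentiation and convergence of measures are pointwise on atoms.
  At time $0$ the derivative is one-sided; values at negative times are irrelevant.
\<close>

definition mf_solution :: "real \<Rightarrow> (bool \<times> bool) pmf \<Rightarrow> (real \<Rightarrow> (bool \<times> bool) pmf) \<Rightarrow> bool" where
  "mf_solution \<alpha> \<mu>0 \<mu> \<longleftrightarrow>
     \<mu> 0 = \<mu>0 \<and>
     (\<forall>t\<ge>0. \<mu> t \<in> P_sym \<and>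
       (\<forall>x. ((\<lambda>s. pmf (\<mu> s) x) has_real_derivative mf_rhs \<alpha> (\<mu> t) x) (at t within {0..})))"

definition fixed_points :: "real \<Rightarrow> (bool \<times> bool) pmf set" where
  "fixed_points \<alpha> = {\<nu> \<in> P_sym. \<forall>x. mf_rhs \<alpha> \<nu> x = 0}"

definition converges_to :: "(real \<Rightarrow> (bool \<times> bool) pmf) \<Rightarrow> (bool \<times> bool) pmf \<Rightarrow> bool" where
  "converges_to \<mu> \<nu> \<longleftrightarrow> (\<forall>x. ((\<lambda>t. pmf (\<mu> t) x) \<longlongrightarrow> pmf \<nu> x) at_top)"

text \<open>
  ``The solution started in $\mu_0$'' is rendered as: a solution exists, it is unique on $[0,\infty)$,
  and it converges. Hence membership is never vacuous.
\<close>

definition attraction_domain :: "real \<Rightarrow> (bool \<times> bool) pmf \<Rightarrow> (bool \<times> bool) pmf set" where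
  "attraction_domain \<alpha> \<nu> =
     {\<mu>0 \<in> P_sym. \<exists>\<mu>. mf_solution \<alpha> \<mu>0 \<mu> \<and>
        (\<forall>\<mu>'. mf_solution \<alpha> \<mu>0 \<mu>' \<longrightarrow> (\<forall>t\<ge>0. \<mu>' t = \<mu> t)) \<and>
        converges_to \<mu> \<nu>}"

definition z_low :: real where
  "z_low = 0"

text \<open>The next two are meaningful only for \<^term>\<open>\<alpha> \<ge> 4\<close>.\<close>

definition z_mid :: "real \<Rightarrow> real" where
  "z_mid \<alpha> = 1/2 - sqrt (1/4 - 1/\<alpha>)"

definition z_upp :: "real \<Rightarrow> real" where
  "z_upp \<alpha> = 1/2 + sqrt (1/4 - 1/\<alpha>)"

definition nu_low :: "bool pmf" where
  "nu_low = bernoulli_pmf z_low"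

definition nu_mid :: "real \<Rightarrow> bool pmf" where
  "nu_mid \<alpha> = bernoulli_pmf (z_mid \<alpha>)"

definition nu_upp :: "real \<Rightarrow> bool pmf" where
  "nu_upp \<alpha> = bernoulli_pmf (z_upp \<alpha>)"

end

theory Submission
  imports Defs
begin

text \<open>
  A symmetric law on \<open>{0,1}\<^sup>2\<close> is determined by \<open>p = P(X\<^sub>1 = 1)\<close> and \<open>u = P(X\<^sub>1 = 1, X\<^sub>2 = 0)\<close>, in which the
  mean-field equation is triangular: \<open>p' = Dp \<alpha> p\<close>, \<open>u' = Du \<alpha> p u\<close>. The difference from an
  equilibrium, and the difference of two solutions, satisfy scalar linear equations \<open>x' = h x\<close>
  with bounded \<open>h\<close>, which gives both uniqueness and the preservation of signs. Hence \<open>p\<close> is monotone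
  and converges to a root of \<open>Dp\<close>; then \<open>u\<close> is squeezed to \<open>0\<close> or is eventually monotone and converges
  to a root of \<open>Du\<close> at the limit of \<open>p\<close>. At \<open>p = z_mid\<close> this polynomial has exactly one root in
  \<open>(0, z_mid)\<close> if \<open>\<alpha> > 4\<close>, the off-diagonal fixed point.
\<close>

section \<open>Scalar equations on the half line\<close>

text \<open>Membership in \<open>attraction_domain\<close> demands a global and unique trajectory of
  laws, so well-posedness has to be proved before any limit. The obstacle is that the field is
  polynomial: it is Lipschitz only on the bounded triangle of admissible (p, u), and it is the
  probabilistic origin of the equation that keeps a trajectory there. Convergence is obtained from
  signs and never from rates. A monotone bounded trajectory has a limit, a limit is an equilibrium,
  and order information from the start selects which one. This survives the degenerate case \<alpha>
  = 4, where \<open>z_mid\<close> and \<open>z_upp\<close> merge and linearization at the merged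
  root is inconclusive. The delicate coordinate is u, because \<open>Du\<close> need not have a
  fixed sign while p still moves. For \<alpha> \<ge> 4 and p starting away from
  \<open>z_mid\<close>, p tends to 0 or to \<open>z_upp\<close>, where 0 is the only admissible
  limit of u; near \<open>z_upp\<close> a sign from some time on is then enough. For \<alpha> > 4
  and p starting at \<open>z_mid\<close>, p is constant and u follows an autonomous cubic.\<close>

lemma at_within_Ici_eq: "t > 0 \<Longrightarrow> at t within {0::real..} = at t"
  by (rule at_within_interior) simp

lemma halfline_mono:
  fixes x :: "real \<Rightarrow> real"
  assumes D: "\<And>t. t \<ge> 0 \<Longrightarrow> (x has_real_derivative x' t) (at t within {0..})"
    and nn: "\<And>t. t \<ge> T \<Longrightarrow> x' t \<ge> 0" and "0 \<le> T" "T \<le> s" "s \<le> t"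
  shows "x s \<le> x t"
proof (rule DERIV_nonneg_imp_increasing_open[OF \<open>s \<le> t\<close>])
  show "continuous_on {s..t} x"
  proof (rule continuous_on_subset)
    show "continuous_on {0..} x"
      using D by (intro DERIV_continuous_on) auto
  qed (use assms in auto)
  fix r assume "s < r" "r < t"
  then show "\<exists>y. (x has_real_derivative y) (at r) \<and> 0 \<le> y"
    using D[of r] nn[of r] assms at_within_Ici_eq[of r] by auto
qed

lemma halfline_anti:
  fixes x :: "real \<Rightarrow> real"
  assumes D: "\<And>t. t \<ge> 0 \<Longrightarrow> (x has_real_derivative x' t) (at t within {0..})"
    and np: "\<And>t. t \<ge> T \<Longrightarrow> x' t \<le> 0" and "0 \<le> T" "T \<le> s" "s \<le> t"
  shows "x t \<le> x s"
  using halfline_mono[of "\<lambda>t. - x t" "\<lambda>t. - x' t" T s t] assms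
  by (auto intro!: derivative_eq_intros)

text \<open>The increments \<open>x (t + 1) - x t\<close> tend to \<open>0\<close> and are values of \<open>x'\<close> beyond \<open>t\<close>.\<close>

lemma tendsto_deriv_limit_zero:
  fixes x :: "real \<Rightarrow> real"
  assumes D: "\<And>t. t \<ge> 0 \<Longrightarrow> (x has_real_derivative x' t) (at t within {0..})"
    and lim: "(x \<longlongrightarrow> l) at_top" and lim': "(x' \<longlongrightarrow> L) at_top"
  shows "L = 0"
proof (rule tendsto_unique[OF _ lim'])
  show "at_top \<noteq> (bot :: real filter)" by simp
  have ex: "\<exists>\<xi>. t < \<xi> \<and> \<xi> < t + 1 \<and> x (t + 1) - x t = x' \<xi>" if "t > 0" for t
  proof -
    have "\<exists>\<xi>. t < \<xi> \<and> \<xi> < t + 1 \<and> x (t + 1) - x t = (t + 1 - t) * x' \<xi>"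
    proof (rule MVT2)
      fix r assume "t \<le> r"
      then show "(x has_real_derivative x' r) (at r)"
        using D[of r] that at_within_Ici_eq[of r] by auto
    qed simp
    then show ?thesis by simp
  qed
  have "\<exists>\<xi>. \<forall>t>0. t < \<xi> t \<and> x (t + 1) - x t = x' (\<xi> t)"
    using ex by metis
  then obtain \<xi> where \<xi>: "\<And>t. t > 0 \<Longrightarrow> t < \<xi> t" "\<And>t. t > 0 \<Longrightarrow> x (t + 1) - x t = x' (\<xi> t)"
    by blast
  have "filterlim \<xi> at_top at_top"
    by (rule filterlim_at_top_mono[OF filterlim_ident])
       (use \<xi>(1) in \<open>auto intro!: eventually_mono[OF eventually_gt_at_top[of 0]] less_imp_le\<close>)
  then have "((\<lambda>t. x' (\<xi> t)) \<longlongrightarrow> L) at_top"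
    by (rule filterlim_compose[OF lim'])
  then have 1: "((\<lambda>t. x (t + 1) - x t) \<longlongrightarrow> L) at_top"
    by (rule Lim_transform_eventually)
       (use \<xi>(2) in \<open>auto intro!: eventually_mono[OF eventually_gt_at_top[of 0]]\<close>)
  have "filterlim (\<lambda>t::real. t + 1) at_top at_top"
    by (rule filterlim_at_top_mono[OF filterlim_ident]) auto
  then have "((\<lambda>t. x (t + 1) - x t) \<longlongrightarrow> l - l) at_top"
    by (intro tendsto_diff filterlim_compose[OF lim] lim)
  then have "L = 0"
    using 1 tendsto_unique[OF trivial_limit_at_top_linorder] by fastforce
  with lim' show "(x' \<longlongrightarrow> 0) at_top" by simp
qed

text \<open>The bound \<open>x T \<le> l\<close> is kept beside the limit because the right-hand
  sides have several roots: it rules out those below the starting value.\<close>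

lemma eventually_mono_convergent:
  fixes x :: "real \<Rightarrow> real"
  assumes D: "\<And>t. t \<ge> 0 \<Longrightarrow> (x has_real_derivative x' t) (at t within {0..})"
    and nn: "\<And>t. t \<ge> T \<Longrightarrow> x' t \<ge> 0" and "0 \<le> T"
    and bd: "\<And>t. t \<ge> 0 \<Longrightarrow> x t \<le> b"
  obtains l where "(x \<longlongrightarrow> l) at_top" "x T \<le> l"
proof -
  have m: "x s \<le> x t" if "T \<le> s" "s \<le> t" for s t
    by (rule halfline_mono[OF D nn]) (use that assms in auto)
  define l where "l = (SUP t\<in>{T..}. x t)"
  have bdd: "bdd_above (x ` {T..})"
    using bd \<open>0 \<le> T\<close> by (intro bdd_aboveI[of _ b]) auto
  have up: "x t \<le> l" if "t \<ge> T" for t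
    unfolding l_def by (rule cSUP_upper[OF _ bdd]) (use that in auto)
  have "(x \<longlongrightarrow> l) at_top"
  proof (rule increasing_tendsto)
    show "\<forall>\<^sub>F t in at_top. x t \<le> l"
      using up by (auto intro!: eventually_mono[OF eventually_ge_at_top[of T]])
    fix y assume "y < l"
    then obtain s where "s \<ge> T" "y < x s"
      using less_cSUP_iff[of "{T..}" x y] bdd unfolding l_def by auto
    then have "y < x t" if "t \<ge> s" for t
      using m[of s t] that by linarith
    then show "\<forall>\<^sub>F t in at_top. y < x t"
      by (rule eventually_at_top_linorderI)
  qed
  then show ?thesis using that up[of T] by simp
qed

lemma eventually_anti_convergent:
  fixes x :: "real \<Rightarrow> real"
  assumes D: "\<And>t. t \<ge> 0 \<Longrightarrow> (x has_real_derivative x' t) (at t within {0..})"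
    and np: "\<And>t. t \<ge> T \<Longrightarrow> x' t \<le> 0" and "0 \<le> T"
    and bd: "\<And>t. t \<ge> 0 \<Longrightarrow> b \<le> x t"
  obtains l where "(x \<longlongrightarrow> l) at_top" "l \<le> x T"
proof -
  obtain l where "((\<lambda>t. - x t) \<longlongrightarrow> l) at_top" "- x T \<le> l"
    by (rule eventually_mono_convergent[of "\<lambda>t. - x t" "\<lambda>t. - x' t" T "- b"])
       (use assms in \<open>auto intro!: derivative_eq_intros\<close>)
  then show ?thesis
    using that[of "- l"] tendsto_minus[of "\<lambda>t. - x t" l at_top] by auto
qed

text \<open>The Gronwall estimate is the monotonicity of \<open>x\<^sup>2 exp (\<plusminus> 2 M t)\<close>.\<close>

lemma linear_ode_zero:
  fixes x :: "real \<Rightarrow> real"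
  assumes D: "\<And>t. t \<ge> 0 \<Longrightarrow> (x has_real_derivative x t * h t) (at t within {0..})"
    and h: "\<And>t. t \<ge> 0 \<Longrightarrow> \<bar>h t\<bar> \<le> M" and "x 0 = 0" "t \<ge> 0"
  shows "x t = 0"
proof -
  have "(x t)\<^sup>2 * exp (- 2 * M * t) \<le> (x 0)\<^sup>2 * exp (- 2 * M * 0)"
  proof (rule halfline_anti[where T=0 and x="\<lambda>t. (x t)\<^sup>2 * exp (- 2 * M * t)" and x'="\<lambda>t. 2 * (x t)\<^sup>2 * (h t - M) * exp (- 2 * M * t)"])
    fix s :: real assume s: "0 \<le> s"
    show "((\<lambda>t. (x t)\<^sup>2 * exp (- 2 * M * t)) has_real_derivative
        2 * (x s)\<^sup>2 * (h s - M) * exp (- 2 * M * s)) (at s within {0..})"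
      using D[OF s] by (auto intro!: derivative_eq_intros simp: algebra_simps power2_eq_square)
    show "2 * (x s)\<^sup>2 * (h s - M) * exp (- 2 * M * s) \<le> 0"
      using h[OF s] by (auto intro!: mult_nonneg_nonpos mult_nonpos_nonneg)
  qed (use assms in auto)
  then show ?thesis using \<open>x 0 = 0\<close> by (simp add: mult_le_0_iff)
qed

text \<open>The growing weight bounds \<open>x\<close> away from 0 at every time, and a continuous
  function without zeros keeps its sign.\<close>

lemma linear_ode_pos:
  fixes x :: "real \<Rightarrow> real"
  assumes D: "\<And>t. t \<ge> 0 \<Longrightarrow> (x has_real_derivative x t * h t) (at t within {0..})"
    and h: "\<And>t. t \<ge> 0 \<Longrightarrow> \<bar>h t\<bar> \<le> M" and "x 0 > 0" "t \<ge> 0"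
  shows "x t > 0"
proof (rule ccontr)
  have ne: "x s \<noteq> 0" if "s \<ge> 0" for s
  proof -
    have "(x 0)\<^sup>2 * exp (2 * M * 0) \<le> (x s)\<^sup>2 * exp (2 * M * s)"
    proof (rule halfline_mono[where T=0 and x="\<lambda>t. (x t)\<^sup>2 * exp (2 * M * t)" and x'="\<lambda>t. 2 * (x t)\<^sup>2 * (h t + M) * exp (2 * M * t)"])
      fix s :: real assume s: "0 \<le> s"
      show "((\<lambda>t. (x t)\<^sup>2 * exp (2 * M * t)) has_real_derivative
          2 * (x s)\<^sup>2 * (h s + M) * exp (2 * M * s)) (at s within {0..})"
        using D[OF s] by (auto intro!: derivative_eq_intros simp: algebra_simps power2_eq_square)
      show "0 \<le> 2 * (x s)\<^sup>2 * (h s + M) * exp (2 * M * s)"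
        using h[OF s] by (auto intro!: mult_nonneg_nonneg)
    qed (use that in auto)
    then show ?thesis using \<open>x 0 > 0\<close> by auto
  qed
  assume "\<not> 0 < x t"
  moreover have "continuous_on {0..} x"
    using D by (intro DERIV_continuous_on) auto
  then have "continuous_on {0..t} x" by (rule continuous_on_subset) auto
  ultimately obtain s where "0 \<le> s" "x s = 0"
    using IVT2'[of x t 0 0] \<open>x 0 > 0\<close> \<open>t \<ge> 0\<close> by auto
  with ne show False by blast
qed

lemma linear_ode_neg:
  fixes x :: "real \<Rightarrow> real"
  assumes D: "\<And>t. t \<ge> 0 \<Longrightarrow> (x has_real_derivative x t * h t) (at t within {0..})"
    and h: "\<And>t. t \<ge> 0 \<Longrightarrow> \<bar>h t\<bar> \<le> M" and "x 0 < 0" "t \<ge> 0"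
  shows "x t < 0"
  using linear_ode_pos[of "\<lambda>t. - x t" h M t] assms
  by (auto intro!: derivative_eq_intros)

section \<open>Global solutions for Lipschitz fields\<close>

lemma indefinite_integral_derivative:
  fixes g :: "real \<Rightarrow> 'a::banach"
  assumes "continuous_on UNIV g" "t \<ge> 0"
  shows "((\<lambda>u. integral {0..u} g) has_vector_derivative g t) (at t within {0..})"
proof -
  have "at t within {0..} = at t within {0..t + 1}"
    by (rule at_within_nhd[where S="{..<t + 1}"]) auto
  then show ?thesis
    using integral_has_vector_derivative[of 0 "t + 1" g t] assms continuous_on_subset[of UNIV g]
    by auto
qed

text \<open>Integrating \<open>exp (k * s)\<close> and damping by \<open>exp (- k * t)\<close> gains
  a factor \<open>1 / k\<close>. This gain makes the weighted Picard operator both bounded and, for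
  large \<open>k\<close>, contracting.\<close>

lemma weighted_integral_bound:
  fixes g :: "real \<Rightarrow> 'a::banach"
  assumes g: "continuous_on UNIV g" and b: "\<And>s. s \<ge> 0 \<Longrightarrow> norm (g s) \<le> C * exp (k * s)"
    and "k > 0" "C \<ge> 0" "t \<ge> 0"
  shows "norm (exp (- k * t) *\<^sub>R integral {0..t} g) \<le> C / k"
proof -
  have I: "((\<lambda>s. C * exp (k * s)) has_integral C / k * exp (k * t) - C / k * exp (k * 0)) {0..t}"
    by (rule fundamental_theorem_of_calculus[OF \<open>t \<ge> 0\<close>])
       (use \<open>k > 0\<close> in \<open>auto intro!: derivative_eq_intros simp flip: has_real_derivative_iff_has_vector_derivative\<close>)
  have "norm (integral {0..t} g) \<le> integral {0..t} (\<lambda>s. C * exp (k * s))"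
    by (rule integral_norm_bound_integral)
       (use b I in \<open>auto intro!: integrable_continuous_real continuous_on_subset[OF g] continuous_intros\<close>)
  also have "\<dots> = C / k * exp (k * t) - C / k"
    using integral_unique[OF I] by simp
  also have "\<dots> \<le> C / k * exp (k * t)"
    using assms by simp
  finally have "exp (- k * t) * norm (integral {0..t} g) \<le> exp (- k * t) * (C / k * exp (k * t))"
    by (intro mult_left_mono) auto
  also have "\<dots> = C / k"
    by (simp add: exp_minus)
  finally show ?thesis by simp
qed

text \<open>
  The Picard operator is a contraction on the bounded continuous functions \<open>z\<close> once a solution is
  written as \<open>exp (k t) z t\<close> with \<open>k\<close> larger than the Lipschitz constant; this gives the solution on
  all of \<open>[0, \<infinity>)\<close> in one step.
\<close>

lemma lipschitz_ode_exists:
  fixes F :: "'a::banach \<Rightarrow> 'a"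
  assumes lip: "L-lipschitz_on UNIV F"
  obtains y where "y 0 = y0"
    "\<And>t. t \<ge> 0 \<Longrightarrow> (y has_vector_derivative F (y t)) (at t within {0..})"
proof -
  have "L \<ge> 0" using lip by (rule lipschitz_on_nonneg)
  \<comment> \<open>The contraction factor will be \<open>L / k\<close>, which is below 1/2; the
    summand 1 keeps \<open>k\<close> positive even if \<open>L = 0\<close>.\<close>
  define k where "k = 2 * L + 1"
  have "k > 0" using \<open>L \<ge> 0\<close> by (simp add: k_def)
  have Fc: "continuous_on UNIV F" using lip by (rule lipschitz_on_continuous_on)
  define g where "g z s = F (exp (k * s) *\<^sub>R apply_bcontfun z s)" for z s
  define J where "J z t = y0 + integral {0..t} (g z)" for z t
  \<comment> \<open>Bounded continuous functions live on the whole line here, so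
    \<open>max 0 t\<close> freezes the value \<open>y0\<close> at negative times.\<close>
  define \<Phi> where "\<Phi> z t = exp (- k * max 0 t) *\<^sub>R J z (max 0 t)" for z t
  have gc: "continuous_on UNIV (g z)" for z
    unfolding g_def by (intro continuous_on_compose2[OF Fc] continuous_intros) auto
  have J': "(J z has_vector_derivative g z t) (at t within {0..})" if "t \<ge> 0" for z t
    unfolding J_def using indefinite_integral_derivative[OF gc that]
    by (auto intro!: derivative_eq_intros)
  have \<Phi>: "\<Phi> z \<in> bcontfun" for z
  proof (rule bcontfun_normI)
    have "continuous_on {0..} (J z)"
      using J' by (intro continuous_on_vector_derivative) auto
    then show "continuous_on UNIV (\<Phi> z)"
      unfolding \<Phi>_def by (intro continuous_intros continuous_on_compose2[where f="\<lambda>t. max 0 t" and s=UNIV]) auto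
    define B where "B = norm z"
    have B: "norm (apply_bcontfun z s) \<le> B" for s
      unfolding B_def by (rule norm_bounded)
    have "B \<ge> 0" by (simp add: B_def)
    \<comment> \<open>A Lipschitz field grows at most linearly, so along \<open>exp (k * s)\<close>
      times a bounded function it grows no faster than \<open>exp (k * s)\<close>; hence
      \<open>\<Phi> z\<close> is again bounded.\<close>
    have gb: "norm (g z s) \<le> (norm (F 0) + L * B) * exp (k * s)" if "s \<ge> 0" for s
    proof -
      have "norm (g z s) \<le> norm (F 0) + norm (g z s - F 0)"
        by (metis add.commute diff_add_cancel norm_triangle_ineq)
      also have "norm (g z s - F 0) \<le> L * norm (exp (k * s) *\<^sub>R apply_bcontfun z s - 0)"
        unfolding g_def by (rule lipschitz_on_normD[OF lip]) auto
      also have "\<dots> \<le> L * (exp (k * s) * B)"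
        using B \<open>L \<ge> 0\<close> by (auto intro!: mult_left_mono)
      also have "norm (F 0) \<le> norm (F 0) * exp (k * s)"
        using that \<open>k > 0\<close> by (simp add: mult_le_cancel_left1)
      finally show ?thesis by (simp add: algebra_simps)
    qed
    show "norm (\<Phi> z t) \<le> norm y0 + (norm (F 0) + L * B) / k" for t
    proof -
      define r where "r = max 0 t"
      have "r \<ge> 0" by (simp add: r_def)
      have "norm (\<Phi> z t) \<le> norm (exp (- k * r) *\<^sub>R y0) + norm (exp (- k * r) *\<^sub>R integral {0..r} (g z))"
        unfolding \<Phi>_def J_def r_def scaleR_add_right by (rule norm_triangle_ineq)
      also have "norm (exp (- k * r) *\<^sub>R y0) \<le> norm y0"
        using \<open>r \<ge> 0\<close> \<open>k > 0\<close> by (auto intro!: mult_left_le_one_le)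
      also have "norm (exp (- k * r) *\<^sub>R integral {0..r} (g z)) \<le> (norm (F 0) + L * B) / k"
        using \<open>B \<ge> 0\<close> \<open>L \<ge> 0\<close> by (intro weighted_integral_bound gc gb \<open>k > 0\<close> \<open>r \<ge> 0\<close>) auto
      finally show ?thesis by simp
    qed
  qed
  define \<Psi> where "\<Psi> z = Bcontfun (\<Phi> z)" for z
  have \<Psi>: "apply_bcontfun (\<Psi> z) = \<Phi> z" for z
    unfolding \<Psi>_def using \<Phi> by (simp add: Bcontfun_inverse)
  have contr: "dist (\<Psi> z) (\<Psi> w) \<le> L / k * dist z w" for z w
  proof (rule dist_bound)
    fix t :: real
    define r where "r = max 0 t"
    have "r \<ge> 0" by (simp add: r_def)
    have "norm (g z s - g w s) \<le> (L * dist z w) * exp (k * s)" for s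
    proof -
      have "norm (g z s - g w s) \<le> L * norm (exp (k * s) *\<^sub>R apply_bcontfun z s - exp (k * s) *\<^sub>R apply_bcontfun w s)"
        unfolding g_def by (rule lipschitz_on_normD[OF lip]) auto
      also have "\<dots> = L * (exp (k * s) * dist (apply_bcontfun z s) (apply_bcontfun w s))"
        by (simp add: dist_norm flip: scaleR_diff_right)
      also have "\<dots> \<le> L * (exp (k * s) * dist z w)"
        using \<open>L \<ge> 0\<close> by (intro mult_left_mono dist_bounded) auto
      finally show ?thesis by (simp add: algebra_simps)
    qed
    then have "norm (exp (- k * r) *\<^sub>R integral {0..r} (\<lambda>s. g z s - g w s)) \<le> L * dist z w / k"
      using \<open>L \<ge> 0\<close> by (intro weighted_integral_bound continuous_intros gc \<open>k > 0\<close> \<open>r \<ge> 0\<close>) auto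
    moreover have "integral {0..r} (\<lambda>s. g z s - g w s) = integral {0..r} (g z) - integral {0..r} (g w)"
      by (intro integral_diff integrable_continuous_real continuous_on_subset[OF gc]) auto
    ultimately show "dist (apply_bcontfun (\<Psi> z) t) (apply_bcontfun (\<Psi> w) t) \<le> L / k * dist z w"
      unfolding \<Psi> \<Phi>_def J_def dist_norm r_def by (simp flip: scaleR_diff_right)
  qed
  have "\<exists>!z. \<Psi> z = z"
    by (rule banach_fix_type[of "L / k"])
       (use contr \<open>L \<ge> 0\<close> \<open>k > 0\<close> in \<open>auto simp: k_def field_simps\<close>)
  then obtain z where z: "\<Psi> z = z" by blast
  \<comment> \<open>The weight cancels at the fixed point: \<open>exp (k * t)\<close> times
    \<open>z\<close> at time \<open>t\<close> is \<open>J z t\<close>, which turns the integral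
    equation into one for \<open>J z\<close> itself.\<close>
  have gJ: "g z t = F (J z t)" if "t \<ge> 0" for t
  proof -
    have "apply_bcontfun z t = exp (- k * t) *\<^sub>R J z t"
      using \<Psi>[of z] z that by (simp add: \<Phi>_def)
    then show ?thesis by (simp add: g_def flip: exp_add)
  qed
  show ?thesis
  proof (rule that[of "J z"])
    show "J z 0 = y0" by (simp add: J_def)
    show "(J z has_vector_derivative F (J z t)) (at t within {0..})" if "t \<ge> 0" for t
      using J'[OF that, of z] gJ[OF that] by simp
  qed
qed

section \<open>Symmetric laws as points of the plane\<close>

definition P1 :: "(bool \<times> bool) pmf \<Rightarrow> real" where
  "P1 \<mu> = pmf \<mu> (True, True) + pmf \<mu> (True, False)"

definition P10 :: "(bool \<times> bool) pmf \<Rightarrow> real" where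
  "P10 \<mu> = pmf \<mu> (True, False)"

text \<open>A single coordinate of the cob image is 1 with probability p + (1 - p) p^2, so the drift
  of p is \<alpha> (1 - p) p^2 - p.\<close>

definition Dp :: "real \<Rightarrow> real \<Rightarrow> real" where
  "Dp \<alpha> p = p * (\<alpha> * p * (1 - p) - 1)"

text \<open>The bivariate cob yields (1,0) from a first pair (1,0), unless both other second
  coordinates are 1, or from a first pair (0,0), if both other first coordinates but not both other
  second coordinates are 1. The probability is u (1 - p^2) + (1 - p - u) (p^2 - (p - u)^2); subtract
  u, multiply by \<alpha> and add the death term - u.\<close>

definition Du :: "real \<Rightarrow> real \<Rightarrow> real \<Rightarrow> real" where
  "Du \<alpha> p u = u * (\<alpha> * (2 * p - 3 * p\<^sup>2 - (1 + p) * u + u\<^sup>2) - 1)"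

text \<open>The inequalities say that the atoms u, p - u and 1 - p - u are nonnegative.\<close>

definition state_space :: "(real \<times> real) set" where
  "state_space = {(p, u). 0 \<le> u \<and> u \<le> p \<and> u \<le> 1 - p}"

lemma UNIV_bool_pair: "(UNIV :: (bool \<times> bool) set) =
  {(True, True), (True, False), (False, True), (False, False)}"
  by (auto simp: UNIV_bool)

lemma sum_pmf_bool_pair: "pmf \<mu> (True, True) + pmf \<mu> (True, False) + pmf \<mu> (False, True)
    + pmf \<mu> (False, False) = 1"
proof -
  have "sum (pmf \<mu>) UNIV = 1" by (rule sum_pmf_eq_1) auto
  then show ?thesis by (simp add: UNIV_bool_pair)
qed

lemma P_sym_iff: "\<mu> \<in> P_sym \<longleftrightarrow> pmf \<mu> (False, True) = pmf \<mu> (True, False)"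
proof -
  have sw: "pmf (map_pmf prod.swap \<mu>) x = pmf \<mu> (prod.swap x)" for x
    using pmf_map_inj'[of prod.swap \<mu> "prod.swap x"] by (simp add: inj_swap)
  show ?thesis
    unfolding P_sym_def by (auto simp: pmf_eq_iff sw all_bool_eq)
qed

lemma pmf_P_sym:
  assumes "\<mu> \<in> P_sym"
  shows "pmf \<mu> (True, True) = P1 \<mu> - P10 \<mu>" "pmf \<mu> (True, False) = P10 \<mu>"
    "pmf \<mu> (False, True) = P10 \<mu>" "pmf \<mu> (False, False) = 1 - P1 \<mu> - P10 \<mu>"
  using assms sum_pmf_bool_pair[of \<mu>] by (auto simp: P_sym_iff P1_def P10_def)

lemma P_sym_eqI:
  assumes "\<mu> \<in> P_sym" "\<nu> \<in> P_sym" "P1 \<mu> = P1 \<nu>" "P10 \<mu> = P10 \<nu>"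
  shows "\<mu> = \<nu>"
proof (rule pmf_eqI)
  fix x :: "bool \<times> bool"
  show "pmf \<mu> x = pmf \<nu> x"
    using pmf_P_sym[OF assms(1)] pmf_P_sym[OF assms(2)] assms(3,4)
    by (cases x; cases "fst x"; cases "snd x") auto
qed

lemma P_sym_state_space: "\<mu> \<in> P_sym \<Longrightarrow> (P1 \<mu>, P10 \<mu>) \<in> state_space"
  using pmf_nonneg[of \<mu> "(True, True)"] pmf_nonneg[of \<mu> "(True, False)"] pmf_nonneg[of \<mu> "(False, False)"]
  by (simp add: state_space_def pmf_P_sym)

text \<open>Every point of the triangle is realized by a law. This turns planar trajectories into
  laws, and it also lets positivity facts about laws be used at arbitrary points of the
  triangle.\<close>

lemma state_space_P_sym:
  assumes "(p, u) \<in> state_space"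
  obtains \<mu> where "\<mu> \<in> P_sym" "P1 \<mu> = p" "P10 \<mu> = u"
proof -
  define f where "f x = (if fst x then if snd x then p - u else u else if snd x then u else 1 - p - u)"
    for x :: "bool \<times> bool"
  have nn: "0 \<le> f x" for x
    using assms by (auto simp: f_def state_space_def)
  have "(\<integral>\<^sup>+x. ennreal (f x) \<partial>count_space UNIV) = 1"
    using nn by (subst nn_integral_count_space_finite) (auto simp: sum_ennreal, simp add: UNIV_bool_pair f_def)
  then have pmf: "pmf (embed_pmf f) x = f x" for x
    using nn by (intro pmf_embed_pmf) auto
  show ?thesis
    by (rule that[of "embed_pmf f"]) (auto simp: P_sym_iff P1_def P10_def pmf f_def)
qed

section \<open>The mean-field operator in the coordinates \<open>P1\<close> and
  \<open>P10\<close>\<close>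

lemma pmf_T_cob: "pmf (T_op 3 (bivariate cob) \<mu>) x =
  (\<Sum>a\<in>UNIV. (\<Sum>b\<in>UNIV. (\<Sum>c\<in>UNIV. of_bool (bivariate cob [a, b, c] = x) * pmf \<mu> c) * pmf \<mu> b) * pmf \<mu> a)"
proof -
  have I: "(\<integral>y. g y \<partial>measure_pmf \<mu>) = (\<Sum>y\<in>UNIV. g y * pmf \<mu> y)" for g
    by (rule integral_measure_pmf_real) auto
  have "T_op 3 (bivariate cob) \<mu> =
      bind_pmf \<mu> (\<lambda>a. bind_pmf \<mu> (\<lambda>b. bind_pmf \<mu> (\<lambda>c. return_pmf (bivariate cob [a, b, c]))))"
    by (simp add: T_op_def numeral_3_eq_3 map_bind_pmf bind_assoc_pmf bind_return_pmf)
  then show ?thesis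
    by (simp add: pmf_bind I indicator_def of_bool_def eq_commute)
qed

lemma pmf_T_dth: "pmf (T_op 0 (bivariate dth) \<mu>) x = of_bool (x = (False, False))"
  by (simp add: T_op_def bivariate_def dth_def indicator_def)

text \<open>The first two equations agree, which is the preservation of exchange symmetry. In the
  third, p is the sum of the atoms (1,1) and (1,0), so the atom (1,1) moves with the difference of
  the two drifts.\<close>

lemma mf_rhs_P_sym:
  assumes "\<mu> \<in> P_sym"
  shows "mf_rhs \<alpha> \<mu> (True, False) = Du \<alpha> (P1 \<mu>) (P10 \<mu>)"
    "mf_rhs \<alpha> \<mu> (False, True) = Du \<alpha> (P1 \<mu>) (P10 \<mu>)"
    "mf_rhs \<alpha> \<mu> (True, True) = Dp \<alpha> (P1 \<mu>) - Du \<alpha> (P1 \<mu>) (P10 \<mu>)"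
    "mf_rhs \<alpha> \<mu> (False, False) = - Dp \<alpha> (P1 \<mu>) - Du \<alpha> (P1 \<mu>) (P10 \<mu>)"
  unfolding mf_rhs_def pmf_T_cob pmf_T_dth UNIV_bool_pair Dp_def Du_def
  \<comment> \<open>Evaluating \<open>cob\<close> on all 64 triples of atoms leaves polynomial
    identities in \<alpha> and the two coordinates.\<close>
  by (simp_all add: bivariate_def cob_def pmf_P_sym[OF assms]) (algebra+)

text \<open>Adding back the loss terms leaves \<alpha> times the cob image plus the dth image, a
  nonnegative combination of probabilities. This is the positivity behind the invariance of the
  triangle.\<close>

lemma mf_rhs_lower: "\<alpha> \<ge> 0 \<Longrightarrow> mf_rhs \<alpha> \<mu> x + (\<alpha> + 1) * pmf \<mu> x \<ge> 0"
  by (simp add: mf_rhs_def algebra_simps)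

lemma mf_rhs_eq_0_iff:
  assumes "\<mu> \<in> P_sym"
  shows "(\<forall>x. mf_rhs \<alpha> \<mu> x = 0) \<longleftrightarrow> Dp \<alpha> (P1 \<mu>) = 0 \<and> Du \<alpha> (P1 \<mu>) (P10 \<mu>) = 0"
  by (auto simp: split_paired_all all_bool_eq mf_rhs_P_sym[OF assms])

section \<open>Marginals and diagonal laws\<close>

lemma P1_marginal: "pmf (marginal \<mu>) True = P1 \<mu>"
proof -
  have "pmf (marginal \<mu>) True = measure_pmf.prob \<mu> {x. fst x}"
    unfolding marginal_def pmf_map by (rule arg_cong[where f="measure_pmf.prob \<mu>"]) auto
  also have "{x. fst x} = {(True, True), (True, False)}"
    by force
  also have "measure_pmf.prob \<mu> {(True, True), (True, False)} = P1 \<mu>"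
    by (simp add: measure_measure_pmf_finite P1_def)
  finally show ?thesis .
qed

lemma marginal_bernoulli_iff:
  assumes "0 \<le> z" "z \<le> 1"
  shows "marginal \<mu> = bernoulli_pmf z \<longleftrightarrow> P1 \<mu> = z"
proof
  assume "P1 \<mu> = z"
  then have "pmf (marginal \<mu>) True = z" by (simp add: P1_marginal)
  moreover have "pmf (marginal \<mu>) True + pmf (marginal \<mu>) False = 1"
    by (simp add: pmf_False_conv_True)
  ultimately show "marginal \<mu> = bernoulli_pmf z"
    using assms by (intro pmf_eqI) (case_tac i; simp)
qed (use assms in \<open>simp flip: P1_marginal\<close>)

lemma on_diagonal_iff: "\<mu> \<in> P_sym \<Longrightarrow> on_diagonal \<mu> \<longleftrightarrow> P10 \<mu> = 0"
  by (simp add: on_diagonal_def measure_measure_pmf_finite pmf_P_sym)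

lemma diag_law_P_sym: "diag_law \<nu> \<in> P_sym"
  by (simp add: diag_law_def P_sym_def pmf.map_comp o_def)

lemma P10_diag_law: "P10 (diag_law \<nu>) = 0"
  unfolding P10_def diag_law_def by (auto simp: pmf_eq_0_set_pmf)

lemma P1_diag_law: "P1 (diag_law \<nu>) = pmf \<nu> True"
  by (simp add: diag_law_def marginal_def pmf.map_comp o_def flip: P1_marginal)

lemma eq_diag_law_iff:
  assumes "\<mu> \<in> P_sym" "0 \<le> z" "z \<le> 1"
  shows "\<mu> = diag_law (bernoulli_pmf z) \<longleftrightarrow> P1 \<mu> = z \<and> P10 \<mu> = 0"
  using assms P_sym_eqI[OF assms(1) diag_law_P_sym, of "bernoulli_pmf z"]
  by (auto simp: P1_diag_law P10_diag_law)

section \<open>Existence and uniqueness\<close>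

lemma lipschitz_on_mult_exists:
  fixes f g :: "'a::heine_borel \<Rightarrow> real"
  assumes f: "\<exists>L. L-lipschitz_on K f" and g: "\<exists>L. L-lipschitz_on K g" and "bounded K"
  shows "\<exists>L. L-lipschitz_on K (\<lambda>x. f x * g x)"
proof -
  obtain L M where L: "L-lipschitz_on K f" and M: "M-lipschitz_on K g" using f g by blast
  then have nn: "0 \<le> L" "0 \<le> M" by (auto dest: lipschitz_on_nonneg)
  have "bounded (f ` K)" "bounded (g ` K)"
    using lipschitz_on_uniformly_continuous[OF L] lipschitz_on_uniformly_continuous[OF M] \<open>bounded K\<close>
    by (auto intro: bounded_uniformly_continuous_image)
  then obtain A B where A: "\<And>x. x \<in> K \<Longrightarrow> \<bar>f x\<bar> \<le> A" and B: "\<And>x. x \<in> K \<Longrightarrow> \<bar>g x\<bar> \<le> B"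
    by (auto simp: bounded_iff)
  \<comment> \<open>The absolute values keep the constant nonnegative even for empty
    \<open>K\<close>, where the bounds \<open>A\<close> and \<open>B\<close> may be
    negative.\<close>
  have "(\<bar>A\<bar> * M + L * \<bar>B\<bar>)-lipschitz_on K (\<lambda>x. f x * g x)"
  proof (rule lipschitz_onI)
    fix x y assume xy: "x \<in> K" "y \<in> K"
    have "\<bar>f x * g x - f y * g y\<bar> = \<bar>f x * (g x - g y) + (f x - f y) * g y\<bar>"
      by (simp add: algebra_simps)
    also have "\<dots> \<le> \<bar>f x\<bar> * \<bar>g x - g y\<bar> + \<bar>f x - f y\<bar> * \<bar>g y\<bar>"
      by (metis abs_mult abs_triangle_ineq)
    also have "\<dots> \<le> \<bar>A\<bar> * (M * dist x y) + (L * dist x y) * \<bar>B\<bar>"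
      using lipschitz_onD[OF L xy] lipschitz_onD[OF M xy] A[OF xy(1)] B[OF xy(2)] nn
      by (intro add_mono mult_mono) (auto simp: dist_real_def)
    finally show "dist (f x * g x) (f y * g y) \<le> (\<bar>A\<bar> * M + L * \<bar>B\<bar>) * dist x y"
      by (simp add: dist_real_def algebra_simps)
  qed (use nn in auto)
  then show ?thesis by blast
qed

lemma state_space_bounds:
  assumes "(p, u) \<in> state_space"
  shows "0 \<le> u" "u \<le> p" "p \<le> 1 - u" "0 \<le> p" "p \<le> 1" "u \<le> 1"
  using assms by (auto simp: state_space_def)

lemma state_space_eq: "state_space = {v. 0 \<le> snd v} \<inter> {v. 0 \<le> fst v - snd v} \<inter> {v. 0 \<le> 1 - fst v - snd v}"
  by (auto simp: state_space_def)

lemma closed_state_space: "closed state_space"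
  unfolding state_space_eq by (intro closed_Int closed_Collect_le continuous_intros)

text \<open>Together with closedness, convexity makes the nearest-point projection onto the triangle
  1-Lipschitz.\<close>

lemma convex_state_space: "convex state_space"
proof (rule convexI)
  fix x y :: "real \<times> real" and a b :: real
  assume *: "x \<in> state_space" "y \<in> state_space" "0 \<le> a" "0 \<le> b" "a + b = 1"
  then have "0 \<le> a * snd x + b * snd y" "0 \<le> a * (fst x - snd x) + b * (fst y - snd y)"
    "0 \<le> a * (1 - fst x - snd x) + b * (1 - fst y - snd y)"
    by (auto simp: state_space_def)
  then show "a *\<^sub>R x + b *\<^sub>R y \<in> state_space"
    using \<open>a + b = 1\<close> by (auto simp: state_space_eq algebra_simps)
qed

lemma bounded_state_space: "bounded state_space"
proof (rule bounded_subset)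
  show "bounded ({0..1::real} \<times> {0..1::real})"
    by (intro bounded_Times) auto
qed (auto simp: state_space_def)

text \<open>Both drifts are polynomials, built from coordinates and constants by operations that
  preserve Lipschitz continuity on a bounded set.\<close>

lemma lipschitz_vector_field:
  "\<exists>L. L-lipschitz_on state_space (\<lambda>v. (Dp \<alpha> (fst v), Du \<alpha> (fst v) (snd v)))"
proof -
  note bd = bounded_state_space
  let ?lip = "\<lambda>f. \<exists>L. L-lipschitz_on state_space f"
  have 1: "?lip (\<lambda>v. fst v)" "?lip (\<lambda>v. snd v)" "\<And>c::real. ?lip (\<lambda>v. c)"
    by (auto intro!: exI[of _ "1::real"] lipschitz_onI simp: dist_Pair_Pair)
  have 2: "?lip (\<lambda>v. f v + g v)" "?lip (\<lambda>v. f v - g v)" if "?lip f" "?lip g" for f g :: "_ \<Rightarrow> real"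
    using that by (blast intro: lipschitz_on_add lipschitz_on_diff)+
  have "?lip (\<lambda>v. Dp \<alpha> (fst v))" "?lip (\<lambda>v. Du \<alpha> (fst v) (snd v))"
    unfolding Dp_def Du_def power2_eq_square
    by (intro 1 2 lipschitz_on_mult_exists[OF _ _ bd])+
  then obtain L M where "L-lipschitz_on state_space (\<lambda>v. Dp \<alpha> (fst v))"
    "M-lipschitz_on state_space (\<lambda>v. Du \<alpha> (fst v) (snd v))"
    by blast
  from lipschitz_on_Pair[OF this] show ?thesis by (rule exI)
qed

text \<open>The integrating factor \<open>exp (c * t)\<close> absorbs the damping and leaves the
  derivative \<open>g t * exp (c * t)\<close>, which is nonnegative.\<close>

lemma damped_nonneg:
  fixes x :: "real \<Rightarrow> real"
  assumes D: "\<And>t. t \<ge> 0 \<Longrightarrow> (x has_real_derivative g t - c * x t) (at t within {0..})"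
    and g: "\<And>t. t \<ge> 0 \<Longrightarrow> 0 \<le> g t" and "0 \<le> x 0" "0 \<le> t"
  shows "0 \<le> x t"
proof -
  have "x 0 * exp (c * 0) \<le> x t * exp (c * t)"
  proof (rule halfline_mono[where T=0 and x="\<lambda>t. x t * exp (c * t)" and x'="\<lambda>t. g t * exp (c * t)"])
    show "((\<lambda>t. x t * exp (c * t)) has_real_derivative g s * exp (c * s)) (at s within {0..})"
      if "0 \<le> s" for s
      using D[OF that] by (auto intro!: derivative_eq_intros simp: algebra_simps)
  qed (use assms in auto)
  with \<open>0 \<le> x 0\<close> have "0 \<le> x t * exp (c * t)" by simp
  then show ?thesis by (simp add: zero_le_mult_iff)
qed

text \<open>Membership in the triangle is built in, as \<open>mf_solution\<close> admits only laws;
  it also supplies the bounds on the cofactors in the linear equations below.\<close>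

definition planar_solution :: "real \<Rightarrow> (real \<Rightarrow> real) \<Rightarrow> (real \<Rightarrow> real) \<Rightarrow> bool" where
  "planar_solution \<alpha> p u \<longleftrightarrow> (\<forall>t\<ge>0. (p t, u t) \<in> state_space \<and>
     (p has_real_derivative Dp \<alpha> (p t)) (at t within {0..}) \<and>
     (u has_real_derivative Du \<alpha> (p t) (u t)) (at t within {0..}))"

text \<open>
  The vector field is extended to the plane by precomposing with the projection onto the state
  space and adding a linear pull-back. With the rate \<open>\<alpha> + 1\<close> the extended flow relaxes towards
  points of the scaled state space, because \<open>\<alpha> T\<^bsub>cob\<^esub> + T\<^bsub>dth\<^esub>\<close> is a positive measure; so it never leaves it.
\<close>

lemma planar_solution_exists:
  assumes "\<alpha> \<ge> 0" and init: "(p0, u0) \<in> state_space"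
  obtains p u where "planar_solution \<alpha> p u" "p 0 = p0" "u 0 = u0"
proof -
  define c where "c = \<alpha> + 1"
  define V where "V v = (Dp \<alpha> (fst v), Du \<alpha> (fst v) (snd v))" for v
  define \<pi> where "\<pi> = closest_point state_space"
  have ne: "state_space \<noteq> {}" using init by auto
  have \<pi>_in: "\<pi> v \<in> state_space" for v
    unfolding \<pi>_def by (rule closest_point_in_set[OF closed_state_space ne])
  have \<pi>_id: "\<pi> v = v" if "v \<in> state_space" for v
    unfolding \<pi>_def by (rule closest_point_self[OF that])
  have \<pi>_lip: "1-lipschitz_on UNIV \<pi>"
    unfolding \<pi>_def using closest_point_lipschitz[OF convex_state_space closed_state_space ne]
    by (intro lipschitz_onI) auto
  define F where "F v = V (\<pi> v) + c *\<^sub>R (\<pi> v - v)" for v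
  have "\<exists>L. L-lipschitz_on UNIV F"
  proof -
    obtain M where "M-lipschitz_on state_space V"
      using lipschitz_vector_field unfolding V_def by blast
    then have "M-lipschitz_on (\<pi> ` UNIV) V"
      by (rule lipschitz_on_subset) (use \<pi>_in in auto)
    with \<pi>_lip have "(M * 1)-lipschitz_on UNIV (\<lambda>v. V (\<pi> v))"
      by (rule lipschitz_on_compose2)
    from lipschitz_on_add[OF this lipschitz_on_cmult[OF lipschitz_on_diff[OF \<pi>_lip lipschitz_on_id]], of c]
    show ?thesis unfolding F_def by (rule exI)
  qed
  then obtain y where y0: "y 0 = (p0, u0)"
    and y': "\<And>t. t \<ge> 0 \<Longrightarrow> (y has_vector_derivative F (y t)) (at t within {0..})"
    using lipschitz_ode_exists by blast
  define p u where "p t = fst (y t)" and "u t = snd (y t)" for t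
  define q w where "q t = fst (\<pi> (y t))" and "w t = snd (\<pi> (y t))" for t
  have p': "(p has_real_derivative Dp \<alpha> (q t) + c * (q t - p t)) (at t within {0..})" if "t \<ge> 0" for t
    using bounded_linear.has_vector_derivative[OF bounded_linear_fst y'[OF that]]
    unfolding p_def q_def by (simp add: has_real_derivative_iff_has_vector_derivative F_def V_def)
  have u': "(u has_real_derivative Du \<alpha> (q t) (w t) + c * (w t - u t)) (at t within {0..})" if "t \<ge> 0" for t
    using bounded_linear.has_vector_derivative[OF bounded_linear_snd y'[OF that]]
    unfolding q_def w_def u_def by (simp add: has_real_derivative_iff_has_vector_derivative F_def V_def)
  \<comment> \<open>These are the gain terms of the atoms (1,0), (1,1) and (0,0) at the projected
    point, which is always a law.\<close>
  have pos: "0 \<le> Du \<alpha> (q t) (w t) + c * w t"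
    "0 \<le> Dp \<alpha> (q t) - Du \<alpha> (q t) (w t) + c * (q t - w t)"
    "0 \<le> - Dp \<alpha> (q t) - Du \<alpha> (q t) (w t) + c * (1 - q t - w t)" for t
  proof -
    have "(q t, w t) \<in> state_space"
      using \<pi>_in[of "y t"] by (simp add: q_def w_def)
    then obtain \<mu> where \<mu>: "\<mu> \<in> P_sym" "P1 \<mu> = q t" "P10 \<mu> = w t"
      by (rule state_space_P_sym)
    show "0 \<le> Du \<alpha> (q t) (w t) + c * w t"
      "0 \<le> Dp \<alpha> (q t) - Du \<alpha> (q t) (w t) + c * (q t - w t)"
      "0 \<le> - Dp \<alpha> (q t) - Du \<alpha> (q t) (w t) + c * (1 - q t - w t)"
      using mf_rhs_lower[OF \<open>\<alpha> \<ge> 0\<close>, of \<mu> "(True, False)"]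
        mf_rhs_lower[OF \<open>\<alpha> \<ge> 0\<close>, of \<mu> "(True, True)"]
        mf_rhs_lower[OF \<open>\<alpha> \<ge> 0\<close>, of \<mu> "(False, False)"]
      by (simp_all add: mf_rhs_P_sym[OF \<mu>(1)] pmf_P_sym[OF \<mu>(1)] \<mu> c_def)
  qed
  have init': "p 0 = p0" "u 0 = u0" by (simp_all add: p_def u_def y0)
  \<comment> \<open>Each atom of the unprojected trajectory satisfies a damped equation whose source
    is evaluated at the projection. The source is nonnegative wherever the trajectory lies, so the
    argument is not circular.\<close>
  have inv: "(p t, u t) \<in> state_space" if "t \<ge> 0" for t
  proof -
    have "0 \<le> u t"
      by (rule damped_nonneg[where g="\<lambda>t. Du \<alpha> (q t) (w t) + c * w t" and c=c])
        (use u' pos init init' that in \<open>auto simp: algebra_simps dest: state_space_bounds\<close>)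
    moreover have "0 \<le> p t - u t"
      by (rule damped_nonneg[where g="\<lambda>t. Dp \<alpha> (q t) - Du \<alpha> (q t) (w t) + c * (q t - w t)" and c=c])
        (use p' u' pos init init' that in \<open>auto intro!: derivative_eq_intros simp: algebra_simps dest: state_space_bounds\<close>)
    moreover have "0 \<le> 1 - p t - u t"
      by (rule damped_nonneg[where g="\<lambda>t. - Dp \<alpha> (q t) - Du \<alpha> (q t) (w t) + c * (1 - q t - w t)" and c=c])
        (use p' u' pos init init' that in \<open>auto intro!: derivative_eq_intros simp: algebra_simps dest: state_space_bounds\<close>)
    ultimately show ?thesis by (simp add: state_space_def)
  qed
  have "planar_solution \<alpha> p u"
    unfolding planar_solution_def
  proof (intro allI impI conjI inv)
    fix t :: real assume "t \<ge> 0"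
    then have "q t = p t" "w t = u t"
      using inv[of t] \<pi>_id[of "y t"] by (auto simp: p_def u_def q_def w_def)
    then show "(p has_real_derivative Dp \<alpha> (p t)) (at t within {0..})"
      "(u has_real_derivative Du \<alpha> (p t) (u t)) (at t within {0..})"
      using p'[OF \<open>t \<ge> 0\<close>] u'[OF \<open>t \<ge> 0\<close>] by simp_all
  qed
  then show ?thesis using init' that by blast
qed

section \<open>Uniqueness\<close>

lemma unit_interval_mult:
  fixes a b :: real
  assumes "0 \<le> a" "a \<le> 1" "0 \<le> b" "b \<le> 1"
  shows "0 \<le> a * b" "a * b \<le> 1"
  using assms by (auto intro: mult_le_one)

lemma abs_scaled_minus_one:
  fixes \<alpha> :: real
  assumes "\<alpha> \<ge> 0" "\<bar>x\<bar> \<le> C"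
  shows "\<bar>\<alpha> * x - 1\<bar> \<le> \<alpha> * C + 1"
proof -
  have "\<bar>\<alpha> * x - 1\<bar> \<le> \<bar>\<alpha> * x\<bar> + 1" by simp
  also have "\<bar>\<alpha> * x\<bar> \<le> \<alpha> * C" using assms by (simp add: abs_mult mult_left_mono)
  finally show ?thesis by simp
qed

text \<open>A difference of values of a polynomial is divisible by the difference of its arguments;
  the quotient is the coefficient \<open>h\<close>. Triangularity dictates the order: once the first
  coordinates agree, \<open>Du\<close> is compared in its last argument only.\<close>

lemma planar_solution_unique:
  assumes "\<alpha> \<ge> 0" and sol: "planar_solution \<alpha> p u" "planar_solution \<alpha> q w"
    and init: "p 0 = q 0" "u 0 = w 0" and "t \<ge> 0"
  shows "p t = q t" "u t = w t"
proof -
  have pq: "p t = q t" if "t \<ge> 0" for t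
  proof -
    have "p t - q t = 0"
    proof (rule linear_ode_zero[where x="\<lambda>t. p t - q t" and M="\<alpha> * 3 + 1"
          and h="\<lambda>t. \<alpha> * (p t + q t - p t * p t - p t * q t - q t * q t) - 1"])
      fix s :: real assume s: "s \<ge> 0"
      show "((\<lambda>t. p t - q t) has_real_derivative
          (p s - q s) * (\<alpha> * (p s + q s - p s * p s - p s * q s - q s * q s) - 1)) (at s within {0..})"
        using sol s unfolding planar_solution_def Dp_def
        by (auto intro!: derivative_eq_intros simp: algebra_simps)
      have *: "0 \<le> p s" "p s \<le> 1" "0 \<le> q s" "q s \<le> 1"
        using sol s by (auto simp: planar_solution_def dest: state_space_bounds)
      note unit_interval_mult[OF *] unit_interval_mult[OF *(1,2) *(1,2)] unit_interval_mult[OF *(3,4) *(3,4)]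
      then show "\<bar>\<alpha> * (p s + q s - p s * p s - p s * q s - q s * q s) - 1\<bar> \<le> \<alpha> * 3 + 1"
        using * by (intro abs_scaled_minus_one[OF \<open>\<alpha> \<ge> 0\<close>] abs_leI) linarith+
    qed (use init that in auto)
    then show ?thesis by simp
  qed
  then show "p t = q t" using \<open>t \<ge> 0\<close> by blast
  have "u t - w t = 0"
  \<comment> \<open>All monomials lie in [0, 1], and 12 is the sum of the absolute values of their
    coefficients.\<close>
  proof (rule linear_ode_zero[where x="\<lambda>t. u t - w t" and M="\<alpha> * 12 + 1"
        and h="\<lambda>t. \<alpha> * (2 * p t - 3 * (p t * p t) - (u t + w t) - p t * u t - p t * w t
            + u t * u t + u t * w t + w t * w t) - 1"])
    fix s :: real assume s: "s \<ge> 0"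
    show "((\<lambda>t. u t - w t) has_real_derivative
        (u s - w s) * (\<alpha> * (2 * p s - 3 * (p s * p s) - (u s + w s) - p s * u s - p s * w s
          + u s * u s + u s * w s + w s * w s) - 1)) (at s within {0..})"
      using sol s pq[OF s] unfolding planar_solution_def Du_def power2_eq_square
      by (auto intro!: derivative_eq_intros simp: algebra_simps)
    have *: "0 \<le> p s" "p s \<le> 1" "0 \<le> u s" "u s \<le> 1" "0 \<le> w s" "w s \<le> 1"
      using sol s by (auto simp: planar_solution_def dest: state_space_bounds)
    note unit_interval_mult[OF *(1,2) *(1,2)] unit_interval_mult[OF *(3,4) *(3,4)]
      unit_interval_mult[OF *(5,6) *(5,6)] unit_interval_mult[OF *(3,4) *(5,6)]
      unit_interval_mult[OF *(1,2) *(3,4)] unit_interval_mult[OF *(1,2) *(5,6)]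
    then show "\<bar>\<alpha> * (2 * p s - 3 * (p s * p s) - (u s + w s) - p s * u s - p s * w s
        + u s * u s + u s * w s + w s * w s) - 1\<bar> \<le> \<alpha> * 12 + 1"
      using * by (intro abs_scaled_minus_one[OF \<open>\<alpha> \<ge> 0\<close>] abs_leI) linarith+
  qed (use init \<open>t \<ge> 0\<close> in auto)
  then show "u t = w t" by simp
qed

section \<open>Passage between laws and planar trajectories\<close>

lemma mf_solution_planar:
  assumes "mf_solution \<alpha> \<mu>0 \<mu>"
  shows "planar_solution \<alpha> (\<lambda>t. P1 (\<mu> t)) (\<lambda>t. P10 (\<mu> t))"
  unfolding planar_solution_def
proof (intro allI impI conjI)
  fix t :: real assume "t \<ge> 0"
  then have sym: "\<mu> t \<in> P_sym"
    and D: "\<And>x. ((\<lambda>s. pmf (\<mu> s) x) has_real_derivative mf_rhs \<alpha> (\<mu> t) x) (at t within {0..})"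
    using assms by (auto simp: mf_solution_def)
  show "(P1 (\<mu> t), P10 (\<mu> t)) \<in> state_space"
    by (rule P_sym_state_space[OF sym])
  show "((\<lambda>t. P10 (\<mu> t)) has_real_derivative Du \<alpha> (P1 (\<mu> t)) (P10 (\<mu> t))) (at t within {0..})"
    using D[of "(True, False)"] unfolding P10_def[abs_def] by (simp add: mf_rhs_P_sym[OF sym] P10_def)
  show "((\<lambda>t. P1 (\<mu> t)) has_real_derivative Dp \<alpha> (P1 (\<mu> t))) (at t within {0..})"
    using DERIV_add[OF D[of "(True, True)"] D[of "(True, False)"]]
    by (simp add: mf_rhs_P_sym[OF sym] flip: P1_def)
qed

lemma planar_mf_solution:
  assumes sol: "planar_solution \<alpha> (\<lambda>t. P1 (\<mu> t)) (\<lambda>t. P10 (\<mu> t))" and sym: "\<And>t. t \<ge> 0 \<Longrightarrow> \<mu> t \<in> P_sym"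
  shows "mf_solution \<alpha> (\<mu> 0) \<mu>"
  unfolding mf_solution_def
proof (intro conjI allI impI sym refl)
  fix t :: real and x :: "bool \<times> bool" assume "t \<ge> 0"
  then have D: "((\<lambda>t. P1 (\<mu> t)) has_real_derivative Dp \<alpha> (P1 (\<mu> t))) (at t within {0..})"
    "((\<lambda>t. P10 (\<mu> t)) has_real_derivative Du \<alpha> (P1 (\<mu> t)) (P10 (\<mu> t))) (at t within {0..})"
    using sol by (auto simp: planar_solution_def)
  \<comment> \<open>Atoms are expressed by the two coordinates only at nonnegative times, where
    symmetry is known; the one-sided derivative sees no others.\<close>
  have tr: "((\<lambda>s. pmf (\<mu> s) x) has_real_derivative mf_rhs \<alpha> (\<mu> t) x) (at t within {0..})"
    if "(f has_real_derivative mf_rhs \<alpha> (\<mu> t) x) (at t within {0..})" "\<And>s. s \<ge> 0 \<Longrightarrow> f s = pmf (\<mu> s) x" for f x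
    by (rule has_field_derivative_transform_within[OF that(1), of 1]) (use that(2) \<open>t \<ge> 0\<close> in auto)
  consider "x = (True, True)" | "x = (True, False)" | "x = (False, True)" | "x = (False, False)"
    by (cases x; cases "fst x"; cases "snd x") auto
  then show "((\<lambda>s. pmf (\<mu> s) x) has_real_derivative mf_rhs \<alpha> (\<mu> t) x) (at t within {0..})"
  proof cases
    case 1
    show ?thesis
      by (rule tr[of "\<lambda>s. P1 (\<mu> s) - P10 (\<mu> s)"])
        (use D sym \<open>t \<ge> 0\<close> in \<open>auto simp: 1 mf_rhs_P_sym pmf_P_sym intro!: derivative_eq_intros\<close>)
  next
    case 2
    show ?thesis
      by (rule tr[of "\<lambda>s. P10 (\<mu> s)"])
        (use D sym \<open>t \<ge> 0\<close> in \<open>auto simp: 2 mf_rhs_P_sym pmf_P_sym\<close>)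
  next
    case 3
    show ?thesis
      by (rule tr[of "\<lambda>s. P10 (\<mu> s)"])
        (use D sym \<open>t \<ge> 0\<close> in \<open>auto simp: 3 mf_rhs_P_sym pmf_P_sym\<close>)
  next
    case 4
    show ?thesis
      by (rule tr[of "\<lambda>s. 1 - P1 (\<mu> s) - P10 (\<mu> s)"])
        (use D sym \<open>t \<ge> 0\<close> in \<open>auto simp: 4 mf_rhs_P_sym pmf_P_sym intro!: derivative_eq_intros\<close>)
  qed
qed

lemma converges_to_P_sym:
  assumes sym: "\<And>t. t \<ge> 0 \<Longrightarrow> \<mu> t \<in> P_sym" "\<nu> \<in> P_sym"
    and lim: "((\<lambda>t. P1 (\<mu> t)) \<longlongrightarrow> P1 \<nu>) at_top" "((\<lambda>t. P10 (\<mu> t)) \<longlongrightarrow> P10 \<nu>) at_top"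
  shows "converges_to \<mu> \<nu>"
  unfolding converges_to_def
proof
  fix x :: "bool \<times> bool"
  have tr: "((\<lambda>s. pmf (\<mu> s) x) \<longlongrightarrow> l) at_top" if "(f \<longlongrightarrow> l) at_top" "\<And>s. s \<ge> 0 \<Longrightarrow> f s = pmf (\<mu> s) x" for f l x
    by (rule Lim_transform_eventually[OF that(1)]) (use that(2) in \<open>auto intro: eventually_at_top_linorderI\<close>)
  consider "x = (True, True)" | "x = (True, False)" | "x = (False, True)" | "x = (False, False)"
    by (cases x; cases "fst x"; cases "snd x") auto
  then show "((\<lambda>s. pmf (\<mu> s) x) \<longlongrightarrow> pmf \<nu> x) at_top"
  proof cases
    case 1
    then show ?thesis
      by (intro tr[of "\<lambda>s. P1 (\<mu> s) - P10 (\<mu> s)"]) (use lim in \<open>auto simp: pmf_P_sym sym intro!: tendsto_intros\<close>)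
  next
    case 2
    then show ?thesis
      by (intro tr[of "\<lambda>s. P10 (\<mu> s)"]) (use lim in \<open>auto simp: pmf_P_sym sym\<close>)
  next
    case 3
    then show ?thesis
      by (intro tr[of "\<lambda>s. P10 (\<mu> s)"]) (use lim in \<open>auto simp: pmf_P_sym sym\<close>)
  next
    case 4
    then show ?thesis
      by (intro tr[of "\<lambda>s. 1 - P1 (\<mu> s) - P10 (\<mu> s)"]) (use lim in \<open>auto simp: pmf_P_sym sym intro!: tendsto_intros\<close>)
  qed
qed

lemma converges_to_unique: "converges_to \<mu> \<nu> \<Longrightarrow> converges_to \<mu> \<nu>' \<Longrightarrow> \<nu> = \<nu>'"
  unfolding converges_to_def by (rule pmf_eqI) (metis tendsto_unique trivial_limit_at_top_linorder)

text \<open>Limits of planar trajectories decide membership in every domain at once: existence and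
  uniqueness put a law into the domain of its limit, and uniqueness of limits keeps it out of all
  others.\<close>

lemma attraction_domain_iff:
  assumes "\<alpha> \<ge> 0" and sym: "\<mu>0 \<in> P_sym" "\<nu> \<in> P_sym"
    and lim: "\<And>p u. planar_solution \<alpha> p u \<Longrightarrow> p 0 = P1 \<mu>0 \<Longrightarrow> u 0 = P10 \<mu>0 \<Longrightarrow>
      (p \<longlongrightarrow> P1 \<nu>) at_top \<and> (u \<longlongrightarrow> P10 \<nu>) at_top"
  shows "\<mu>0 \<in> attraction_domain \<alpha> \<nu>' \<longleftrightarrow> \<nu>' = \<nu>"
proof -
  have conv: "converges_to \<mu> \<nu>" if "mf_solution \<alpha> \<mu>0 \<mu>" for \<mu>
    using lim[OF mf_solution_planar[OF that]] that sym
    by (intro converges_to_P_sym) (auto simp: mf_solution_def)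
  obtain p u where pu: "planar_solution \<alpha> p u" "p 0 = P1 \<mu>0" "u 0 = P10 \<mu>0"
    using planar_solution_exists[OF \<open>\<alpha> \<ge> 0\<close> P_sym_state_space[OF sym(1)]] by blast
  \<comment> \<open>At negative times any symmetric law serves.\<close>
  have "\<exists>\<mu>. \<mu> \<in> P_sym \<and> (t \<ge> 0 \<longrightarrow> P1 \<mu> = p t \<and> P10 \<mu> = u t)" for t
    using pu(1) state_space_P_sym[of "p t" "u t"] sym unfolding planar_solution_def by blast
  then have "\<exists>\<mu>. \<forall>t. \<mu> t \<in> P_sym \<and> (t \<ge> 0 \<longrightarrow> P1 (\<mu> t) = p t \<and> P10 (\<mu> t) = u t)"
    by (intro choice allI)
  then obtain \<mu> where \<mu>: "\<And>t. \<mu> t \<in> P_sym" "\<And>t. t \<ge> 0 \<Longrightarrow> P1 (\<mu> t) = p t" "\<And>t. t \<ge> 0 \<Longrightarrow> P10 (\<mu> t) = u t"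
    by blast
  have "planar_solution \<alpha> (\<lambda>t. P1 (\<mu> t)) (\<lambda>t. P10 (\<mu> t))"
    unfolding planar_solution_def
  proof (intro allI impI conjI)
    fix t :: real assume t: "t \<ge> 0"
    show "(P1 (\<mu> t), P10 (\<mu> t)) \<in> state_space"
      by (rule P_sym_state_space[OF \<mu>(1)])
    show "((\<lambda>t. P1 (\<mu> t)) has_real_derivative Dp \<alpha> (P1 (\<mu> t))) (at t within {0..})"
      by (rule has_field_derivative_transform_within[of p _ _ _ 1])
        (use pu(1) \<mu> t in \<open>auto simp: planar_solution_def\<close>)
    show "((\<lambda>t. P10 (\<mu> t)) has_real_derivative Du \<alpha> (P1 (\<mu> t)) (P10 (\<mu> t))) (at t within {0..})"
      by (rule has_field_derivative_transform_within[of u _ _ _ 1])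
        (use pu(1) \<mu> t in \<open>auto simp: planar_solution_def\<close>)
  qed
  then have "mf_solution \<alpha> (\<mu> 0) \<mu>"
    by (rule planar_mf_solution) (rule \<mu>)
  moreover have "\<mu> 0 = \<mu>0"
    by (rule P_sym_eqI) (use \<mu> sym pu in auto)
  ultimately have sol: "mf_solution \<alpha> \<mu>0 \<mu>" by simp
  have uniq: "\<mu>' t = \<mu> t" if "mf_solution \<alpha> \<mu>0 \<mu>'" "t \<ge> 0" for \<mu>' t
  proof (rule P_sym_eqI)
    have "\<mu>' 0 = \<mu> 0" using that sol by (simp add: mf_solution_def)
    then show "P1 (\<mu>' t) = P1 (\<mu> t)" "P10 (\<mu>' t) = P10 (\<mu> t)"
      using planar_solution_unique[OF \<open>\<alpha> \<ge> 0\<close> mf_solution_planar[OF that(1)] mf_solution_planar[OF sol] _ _ \<open>t \<ge> 0\<close>]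
      by auto
  qed (use that sol in \<open>auto simp: mf_solution_def\<close>)
  show ?thesis
  proof
    assume "\<mu>0 \<in> attraction_domain \<alpha> \<nu>'"
    then show "\<nu>' = \<nu>"
      using conv converges_to_unique by (auto simp: attraction_domain_def)
  next
    assume "\<nu>' = \<nu>"
    then show "\<mu>0 \<in> attraction_domain \<alpha> \<nu>'"
      using sol uniq conv[OF sol] sym unfolding attraction_domain_def by blast
  qed
qed

section \<open>Convergence\<close>

lemma planar_solutionD:
  assumes "planar_solution \<alpha> p u" "t \<ge> 0"
  shows "(p t, u t) \<in> state_space"
    "(p has_real_derivative Dp \<alpha> (p t)) (at t within {0..})"
    "(u has_real_derivative Du \<alpha> (p t) (u t)) (at t within {0..})"
  using assms by (auto simp: planar_solution_def)

lemma planar_solution_limit_in: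
  assumes sol: "planar_solution \<alpha> p u" and "(p \<longlongrightarrow> l) at_top" "(u \<longlongrightarrow> m) at_top"
  shows "(l, m) \<in> state_space"
proof (rule Lim_in_closed_set[OF closed_state_space])
  show "((\<lambda>t. (p t, u t)) \<longlongrightarrow> (l, m)) at_top"
    using assms by (intro tendsto_Pair)
  show "\<forall>\<^sub>F t in at_top. (p t, u t) \<in> state_space"
    using planar_solutionD(1)[OF sol] by (rule eventually_at_top_linorderI)
qed simp

lemma Dp_limit:
  assumes sol: "planar_solution \<alpha> p u" and lim: "(p \<longlongrightarrow> l) at_top"
  shows "Dp \<alpha> l = 0"
proof (rule tendsto_deriv_limit_zero[OF planar_solutionD(2)[OF sol] lim])
  show "((\<lambda>t. Dp \<alpha> (p t)) \<longlongrightarrow> Dp \<alpha> l) at_top"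
    unfolding Dp_def by (intro tendsto_intros lim)
qed

lemma Du_limit:
  assumes sol: "planar_solution \<alpha> p u" and lim: "(p \<longlongrightarrow> l) at_top" "(u \<longlongrightarrow> m) at_top"
  shows "Du \<alpha> l m = 0"
proof (rule tendsto_deriv_limit_zero[OF planar_solutionD(3)[OF sol] lim(2)])
  show "((\<lambda>t. Du \<alpha> (p t) (u t)) \<longlongrightarrow> Du \<alpha> l m) at_top"
    unfolding Du_def by (intro tendsto_intros lim)
qed

lemma p_increasing_limit:
  assumes sol: "planar_solution \<alpha> p u" and "\<And>t. t \<ge> 0 \<Longrightarrow> Dp \<alpha> (p t) \<ge> 0"
  obtains l where "(p \<longlongrightarrow> l) at_top" "Dp \<alpha> l = 0" "p 0 \<le> l"
proof -
  have bd: "p t \<le> 1" if "t \<ge> 0" for t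
    using planar_solutionD(1)[OF sol that] state_space_bounds by blast
  obtain l where l: "(p \<longlongrightarrow> l) at_top" "p 0 \<le> l"
    using eventually_mono_convergent[of p _ 0 1, OF planar_solutionD(2)[OF sol] assms(2) order_refl bd]
    by blast
  from that[OF l(1) Dp_limit[OF sol l(1)] l(2)] show ?thesis .
qed

lemma p_decreasing_limit:
  assumes sol: "planar_solution \<alpha> p u" and "\<And>t. t \<ge> 0 \<Longrightarrow> Dp \<alpha> (p t) \<le> 0"
  obtains l where "(p \<longlongrightarrow> l) at_top" "Dp \<alpha> l = 0" "0 \<le> l" "l \<le> p 0"
proof -
  have bd: "0 \<le> p t" if "t \<ge> 0" for t
    using planar_solutionD(1)[OF sol that] state_space_bounds by blast
  obtain l where l: "(p \<longlongrightarrow> l) at_top" "l \<le> p 0"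
    using eventually_anti_convergent[of p _ 0 0, OF planar_solutionD(2)[OF sol] assms(2) order_refl bd]
    by blast
  have "0 \<le> l"
    by (rule tendsto_lowerbound[OF l(1)]) (auto intro: eventually_at_top_linorderI bd)
  with that[OF l(1) Dp_limit[OF sol l(1)] _ l(2)] show ?thesis .
qed

lemma u_increasing_limit:
  assumes sol: "planar_solution \<alpha> p u" and p: "(p \<longlongrightarrow> l) at_top"
    and "\<And>t. t \<ge> 0 \<Longrightarrow> Du \<alpha> (p t) (u t) \<ge> 0"
  obtains m where "(u \<longlongrightarrow> m) at_top" "Du \<alpha> l m = 0" "(l, m) \<in> state_space" "u 0 \<le> m"
proof -
  have bd: "u t \<le> 1" if "t \<ge> 0" for t
    using planar_solutionD(1)[OF sol that] state_space_bounds by blast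
  obtain m where m: "(u \<longlongrightarrow> m) at_top" "u 0 \<le> m"
    using eventually_mono_convergent[of u _ 0 1, OF planar_solutionD(3)[OF sol] assms(3) order_refl bd]
    by blast
  from that[OF m(1) Du_limit[OF sol p m(1)] planar_solution_limit_in[OF sol p m(1)] m(2)] show ?thesis .
qed

text \<open>The starting time \<open>T\<close> is free because near \<open>z_upp\<close> the sign of
  \<open>Du\<close> may be known only once p is close to its limit.\<close>

lemma u_decreasing_limit:
  assumes sol: "planar_solution \<alpha> p u" and p: "(p \<longlongrightarrow> l) at_top"
    and "\<And>t. t \<ge> T \<Longrightarrow> Du \<alpha> (p t) (u t) \<le> 0" "T \<ge> 0"
  obtains m where "(u \<longlongrightarrow> m) at_top" "Du \<alpha> l m = 0" "(l, m) \<in> state_space"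
proof -
  have bd: "0 \<le> u t" if "t \<ge> 0" for t
    using planar_solutionD(1)[OF sol that] state_space_bounds by blast
  obtain m where m: "(u \<longlongrightarrow> m) at_top"
    using eventually_anti_convergent[of u _ T 0, OF planar_solutionD(3)[OF sol] assms(3) assms(4) bd]
    by blast
  from that[OF m(1) Du_limit[OF sol p m(1)] planar_solution_limit_in[OF sol p m(1)]] show ?thesis .
qed

lemma u_limit_zero:
  assumes sol: "planar_solution \<alpha> p u" and "(p \<longlongrightarrow> 0) at_top"
  shows "(u \<longlongrightarrow> 0) at_top"
proof (rule tendsto_sandwich[OF _ _ tendsto_const assms(2)])
  show "\<forall>\<^sub>F t in at_top. 0 \<le> u t" "\<forall>\<^sub>F t in at_top. u t \<le> p t"
    using state_space_bounds[OF planar_solutionD(1)[OF sol]]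
    by (auto intro: eventually_at_top_linorderI)
qed

section \<open>Equilibria and limits of the marginal\<close>

text \<open>The two numbers are the roots of \<alpha> p (1 - p) = 1. Their sum and product are what
  the later factorizations use in place of the square root.\<close>

lemma z_mid_upp:
  assumes "\<alpha> \<ge> 4"
  shows "0 < z_mid \<alpha>" "z_mid \<alpha> \<le> 1 / 2" "1 / 2 \<le> z_upp \<alpha>" "z_upp \<alpha> < 1"
    "z_mid \<alpha> + z_upp \<alpha> = 1" "\<alpha> * (z_mid \<alpha> * z_upp \<alpha>) = 1"
    "\<alpha> > 4 \<Longrightarrow> z_mid \<alpha> < 1 / 2" "\<alpha> > 4 \<Longrightarrow> 1 / 2 < z_upp \<alpha>"
    "\<alpha> = 4 \<Longrightarrow> z_mid \<alpha> = 1 / 2" "\<alpha> = 4 \<Longrightarrow> z_upp \<alpha> = 1 / 2"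
proof -
  define s where "s = sqrt (1/4 - 1/\<alpha>)"
  have nn: "0 \<le> 1/4 - 1/\<alpha>" using assms by (simp add: field_simps)
  then have s: "0 \<le> s" "s * s = 1/4 - 1/\<alpha>" by (simp_all add: s_def)
  have "s < 1 / 2"
  proof (rule ccontr)
    assume "\<not> s < 1 / 2"
    then have "1 / 2 * (1 / 2) \<le> s * s" by (intro mult_mono) auto
    moreover have "0 < 1 / \<alpha>" using assms by simp
    ultimately show False using s by linarith
  qed
  then show "0 < z_mid \<alpha>" "z_mid \<alpha> \<le> 1 / 2" "1 / 2 \<le> z_upp \<alpha>" "z_upp \<alpha> < 1"
    "z_mid \<alpha> + z_upp \<alpha> = 1"
    using s by (simp_all add: z_mid_def z_upp_def flip: s_def)
  have "z_mid \<alpha> * z_upp \<alpha> = 1 / \<alpha>"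
    using s(2) by (simp add: z_mid_def z_upp_def algebra_simps flip: s_def)
  then show "\<alpha> * (z_mid \<alpha> * z_upp \<alpha>) = 1" using assms by simp
  show "z_mid \<alpha> < 1 / 2" "1 / 2 < z_upp \<alpha>" if "\<alpha> > 4"
    using that by (simp_all add: z_mid_def z_upp_def field_simps)
  show "z_mid \<alpha> = 1 / 2" "z_upp \<alpha> = 1 / 2" if "\<alpha> = 4"
    using that by (simp_all add: z_mid_def z_upp_def)
qed

lemma Dp_factor:
  assumes "\<alpha> \<ge> 4"
  shows "Dp \<alpha> x = - \<alpha> * x * (x - z_mid \<alpha>) * (x - z_upp \<alpha>)"
  using z_mid_upp(5,6)[OF assms] unfolding Dp_def by algebra

lemma Dp_eq_0_iff:
  assumes "\<alpha> \<ge> 4"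
  shows "Dp \<alpha> x = 0 \<longleftrightarrow> x = 0 \<or> x = z_mid \<alpha> \<or> x = z_upp \<alpha>"
  using assms by (auto simp: Dp_factor)

lemma p_cofactor_bound:
  assumes "\<alpha> \<ge> 0" "(x, y) \<in> state_space" "0 \<le> z" "z \<le> 1"
  shows "\<bar>- \<alpha> * x * (x - z)\<bar> \<le> \<alpha>"
proof -
  have "0 \<le> x" "x \<le> 1" using state_space_bounds[OF assms(2)] by auto
  then have "\<bar>x\<bar> * \<bar>x - z\<bar> \<le> 1 * 1" using assms by (intro mult_mono) auto
  then have "\<alpha> * (\<bar>x\<bar> * \<bar>x - z\<bar>) \<le> \<alpha> * 1" using assms by (intro mult_left_mono) auto
  then show ?thesis using assms by (simp add: abs_mult)
qed

lemma p_sign: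
  assumes \<alpha>: "\<alpha> \<ge> 4" and sol: "planar_solution \<alpha> p u" and "t \<ge> 0"
  shows "p 0 < z_mid \<alpha> \<Longrightarrow> p t < z_mid \<alpha>" "p 0 = z_mid \<alpha> \<Longrightarrow> p t = z_mid \<alpha>"
    "p 0 > z_mid \<alpha> \<Longrightarrow> p t > z_mid \<alpha>"
    "p 0 < z_upp \<alpha> \<Longrightarrow> p t < z_upp \<alpha>" "p 0 = z_upp \<alpha> \<Longrightarrow> p t = z_upp \<alpha>"
    "p 0 > z_upp \<alpha> \<Longrightarrow> p t > z_upp \<alpha>"
proof -
  note z = z_mid_upp[OF \<alpha>]
  have D1: "((\<lambda>t. p t - z_mid \<alpha>) has_real_derivative (p s - z_mid \<alpha>) * (- \<alpha> * p s * (p s - z_upp \<alpha>)))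
      (at s within {0..})" if "s \<ge> 0" for s
    using planar_solutionD(2)[OF sol that]
    by (auto intro!: derivative_eq_intros simp: Dp_factor[OF \<alpha>])
  have D2: "((\<lambda>t. p t - z_upp \<alpha>) has_real_derivative (p s - z_upp \<alpha>) * (- \<alpha> * p s * (p s - z_mid \<alpha>)))
      (at s within {0..})" if "s \<ge> 0" for s
    using planar_solutionD(2)[OF sol that]
    by (auto intro!: derivative_eq_intros simp: Dp_factor[OF \<alpha>])
  have b1: "\<bar>- \<alpha> * p s * (p s - z_upp \<alpha>)\<bar> \<le> \<alpha>" if "s \<ge> 0" for s
    using p_cofactor_bound[OF _ planar_solutionD(1)[OF sol that]] \<alpha> z by simp
  have b2: "\<bar>- \<alpha> * p s * (p s - z_mid \<alpha>)\<bar> \<le> \<alpha>" if "s \<ge> 0" for s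
    using p_cofactor_bound[OF _ planar_solutionD(1)[OF sol that]] \<alpha> z by simp
  show "p 0 < z_mid \<alpha> \<Longrightarrow> p t < z_mid \<alpha>" "p 0 = z_mid \<alpha> \<Longrightarrow> p t = z_mid \<alpha>"
    "p 0 > z_mid \<alpha> \<Longrightarrow> p t > z_mid \<alpha>"
    using linear_ode_neg[OF D1 b1 _ \<open>t \<ge> 0\<close>] linear_ode_zero[OF D1 b1 _ \<open>t \<ge> 0\<close>]
      linear_ode_pos[OF D1 b1 _ \<open>t \<ge> 0\<close>] by simp_all
  show "p 0 < z_upp \<alpha> \<Longrightarrow> p t < z_upp \<alpha>" "p 0 = z_upp \<alpha> \<Longrightarrow> p t = z_upp \<alpha>"
    "p 0 > z_upp \<alpha> \<Longrightarrow> p t > z_upp \<alpha>"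
    using linear_ode_neg[OF D2 b2 _ \<open>t \<ge> 0\<close>] linear_ode_zero[OF D2 b2 _ \<open>t \<ge> 0\<close>]
      linear_ode_pos[OF D2 b2 _ \<open>t \<ge> 0\<close>] by simp_all
qed

lemma limit_below_mid:
  assumes \<alpha>: "\<alpha> \<ge> 4" and sol: "planar_solution \<alpha> p u" and "p 0 < z_mid \<alpha>"
  shows "(p \<longlongrightarrow> 0) at_top" "(u \<longlongrightarrow> 0) at_top"
proof -
  note z = z_mid_upp[OF \<alpha>]
  have "Dp \<alpha> (p t) \<le> 0" if "t \<ge> 0" for t
  proof -
    have "0 \<le> p t" "p t < z_mid \<alpha>" "p t < z_upp \<alpha>"
      using p_sign(1)[OF \<alpha> sol that] assms(3) z state_space_bounds(4)[OF planar_solutionD(1)[OF sol that]]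
      by auto
    then have "0 \<le> (\<alpha> * p t) * ((z_mid \<alpha> - p t) * (z_upp \<alpha> - p t))"
      using \<alpha> by (intro mult_nonneg_nonneg) auto
    then show ?thesis by (simp add: Dp_factor[OF \<alpha>] algebra_simps)
  qed
  then obtain l where l: "(p \<longlongrightarrow> l) at_top" "Dp \<alpha> l = 0" "l \<le> p 0"
    using p_decreasing_limit[OF sol] by blast
  \<comment> \<open>The other roots are at least \<open>z_mid\<close>, hence exceed
    \<open>p 0\<close> and cannot be the limit of a decreasing p.\<close>
  then have "l = 0" using assms z by (auto simp: Dp_eq_0_iff[OF \<alpha>])
  with l show "(p \<longlongrightarrow> 0) at_top" by simp
  with sol show "(u \<longlongrightarrow> 0) at_top" by (rule u_limit_zero)
qed

lemma limit_subcritical: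
  assumes \<alpha>: "0 \<le> \<alpha>" "\<alpha> < 4" and sol: "planar_solution \<alpha> p u"
  shows "(p \<longlongrightarrow> 0) at_top" "(u \<longlongrightarrow> 0) at_top"
proof -
  \<comment> \<open>Completing the square gives x (1 - x) \<le> 1/4, and \<alpha> / 4 < 1.\<close>
  have neg: "\<alpha> * x * (1 - x) - 1 < 0" for x
  proof -
    have "0 \<le> \<alpha> * (x - 1/2)\<^sup>2" using \<alpha> by simp
    then show ?thesis using \<alpha> by (simp add: power2_eq_square algebra_simps)
  qed
  have "Dp \<alpha> (p t) \<le> 0" if "t \<ge> 0" for t
    using state_space_bounds(4)[OF planar_solutionD(1)[OF sol that]] neg[of "p t"]
    unfolding Dp_def by (intro mult_nonneg_nonpos) auto
  then obtain l where l: "(p \<longlongrightarrow> l) at_top" "Dp \<alpha> l = 0"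
    using p_decreasing_limit[OF sol] by blast
  then have "l = 0" using neg[of l] by (auto simp: Dp_def)
  with l show "(p \<longlongrightarrow> 0) at_top" by simp
  with sol show "(u \<longlongrightarrow> 0) at_top" by (rule u_limit_zero)
qed

section \<open>The off-diagonal mass and the remaining limits\<close>

text \<open>Since y \<le> 1 + x on the triangle, the terms in y only lower the bracket of
  \<open>Du\<close>. Its value at y = 0, the growth rate of a small off-diagonal mass, therefore
  controls the sign.\<close>

lemma Du_bound:
  assumes "\<alpha> \<ge> 0" "(x, y) \<in> state_space" "\<alpha> * (2 * x - 3 * x\<^sup>2) - 1 \<le> 0"
  shows "Du \<alpha> x y \<le> 0"
proof -
  have "y * (y - (1 + x)) \<le> 0"
    using state_space_bounds[OF assms(2)] by (intro mult_nonneg_nonpos) auto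
  then have "\<alpha> * (y * (y - (1 + x))) \<le> 0" using assms(1) by (rule mult_nonneg_nonpos[rotated])
  then have "\<alpha> * (2 * x - 3 * x\<^sup>2 - (1 + x) * y + y\<^sup>2) - 1 \<le> 0"
    using assms(3) by (simp add: algebra_simps power2_eq_square)
  then show ?thesis
    unfolding Du_def using state_space_bounds(1)[OF assms(2)] by (rule mult_nonneg_nonpos[rotated])
qed

text \<open>
  At an equilibrium \<open>z\<close> of the marginal, \<open>\<alpha> z (1 - z) = 1\<close> removes the death term from \<open>Du\<close>; the two
  quadratic factors at \<open>z_mid\<close> and \<open>z_upp\<close> differ in the sign of \<open>1 - 2 z\<close>.
\<close>

lemma Du_equilibrium:
  assumes "\<alpha> * (z * (1 - z)) = 1"
  shows "Du \<alpha> z y = \<alpha> * y * (y\<^sup>2 - (1 + z) * y + z * (1 - 2 * z))"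
  using assms unfolding Du_def by algebra

text \<open>As z = \<open>z_upp\<close> is at least 1/2, the constant term z (1 - 2 z) is
  nonpositive, while m (m - (1 + z)) is strictly negative for m > 0. The quadratic factor thus has
  no admissible positive root, also at \<alpha> = 4 where its constant term vanishes.\<close>

lemma Du_upp_eq_0:
  assumes \<alpha>: "\<alpha> \<ge> 4" and Du: "Du \<alpha> (z_upp \<alpha>) m = 0" and m: "(z_upp \<alpha>, m) \<in> state_space"
  shows "m = 0"
proof (rule ccontr)
  note z = z_mid_upp[OF \<alpha>]
  assume "m \<noteq> 0"
  then have "m > 0" using state_space_bounds(1)[OF m] by simp
  have "z_mid \<alpha> = 1 - z_upp \<alpha>" using z by simp
  then have "\<alpha> * (z_upp \<alpha> * (1 - z_upp \<alpha>)) = 1" using z(6) by (simp add: mult.commute)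
  from Du_equilibrium[OF this] Du \<open>m \<noteq> 0\<close> \<alpha>
  have "m\<^sup>2 - (1 + z_upp \<alpha>) * m + z_upp \<alpha> * (1 - 2 * z_upp \<alpha>) = 0" by auto
  moreover have "z_upp \<alpha> * (1 - 2 * z_upp \<alpha>) \<le> 0"
    using z by (intro mult_nonneg_nonpos) auto
  moreover have "m * (m - (1 + z_upp \<alpha>)) < 0"
    using \<open>m > 0\<close> state_space_bounds[OF m] z by (intro mult_pos_neg) auto
  ultimately show False by (simp add: power2_eq_square algebra_simps)
qed

lemma limit_above_mid:
  assumes \<alpha>: "\<alpha> \<ge> 4" and sol: "planar_solution \<alpha> p u"
    and init: "p 0 > z_mid \<alpha> \<or> \<alpha> = 4 \<and> p 0 = z_mid \<alpha>"
  shows "(p \<longlongrightarrow> z_upp \<alpha>) at_top" "(u \<longlongrightarrow> 0) at_top"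
proof -
  note z = z_mid_upp[OF \<alpha>]
  have pm: "z_mid \<alpha> \<le> p t" if "t \<ge> 0" for t
    using p_sign(2,3)[OF \<alpha> sol that] init by auto
  show p: "(p \<longlongrightarrow> z_upp \<alpha>) at_top"
  proof (cases "p 0 < z_upp \<alpha>")
    case True
    have "Dp \<alpha> (p t) \<ge> 0" if "t \<ge> 0" for t
    proof -
      have "0 \<le> (\<alpha> * p t) * ((p t - z_mid \<alpha>) * (z_upp \<alpha> - p t))"
        using p_sign(4)[OF \<alpha> sol that True] pm[OF that] \<alpha> z by (intro mult_nonneg_nonneg) auto
      then show ?thesis by (simp add: Dp_factor[OF \<alpha>] algebra_simps)
    qed
    then obtain l where l: "(p \<longlongrightarrow> l) at_top" "Dp \<alpha> l = 0" "p 0 \<le> l"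
      using p_increasing_limit[OF sol] by blast
    then have "l = z_upp \<alpha>" using init True z by (auto simp: Dp_eq_0_iff[OF \<alpha>])
    with l show ?thesis by simp
  next
    case False
    have pu: "z_upp \<alpha> \<le> p t" if "t \<ge> 0" for t
      using p_sign(5,6)[OF \<alpha> sol that] False by linarith
    have "Dp \<alpha> (p t) \<le> 0" if "t \<ge> 0" for t
    proof -
      have "0 \<le> (\<alpha> * p t) * ((p t - z_mid \<alpha>) * (p t - z_upp \<alpha>))"
        using pu[OF that] pm[OF that] \<alpha> z by (intro mult_nonneg_nonneg) auto
      then show ?thesis by (simp add: Dp_factor[OF \<alpha>] algebra_simps)
    qed
    then obtain l where l: "(p \<longlongrightarrow> l) at_top" "Dp \<alpha> l = 0"
      using p_decreasing_limit[OF sol] by blast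
    have "z_upp \<alpha> \<le> l"
      by (rule tendsto_lowerbound[OF l(1)]) (auto intro: eventually_at_top_linorderI pu)
    then have "l = z_upp \<alpha>" using l(2) z \<alpha> by (auto simp: Dp_eq_0_iff[OF \<alpha>])
    with l show ?thesis by simp
  qed
  \<comment> \<open>The growth rate required by \<open>Du_bound\<close>. For \<alpha> > 4 its limit
    is strictly negative, so continuity suffices. For \<alpha> = 4 the limit is 0 and continuity
    says nothing; there the rate is - (2 p - 1) (6 p - 1), which is nonpositive for p \<ge>
    1/2.\<close>
  have "\<forall>\<^sub>F t in at_top. \<alpha> * (2 * p t - 3 * (p t)\<^sup>2) - 1 \<le> 0"
  proof (cases "\<alpha> = 4")
    case True
    have "4 * (2 * p t - 3 * (p t)\<^sup>2) - 1 \<le> 0" if "t \<ge> 0" for t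
    proof -
      have "0 \<le> (2 * p t - 1) * (6 * p t - 1)"
        using pm[OF that] z(9)[OF True] by (intro mult_nonneg_nonneg) auto
      then show ?thesis by (simp add: power2_eq_square algebra_simps)
    qed
    then show ?thesis using True by (auto intro: eventually_at_top_linorderI)
  next
    case False
    define Z where "Z = z_upp \<alpha>"
    have "z_mid \<alpha> = 1 - Z" using z by (simp add: Z_def)
    then have "\<alpha> * (Z * (1 - Z)) = 1" using z(6) by (simp add: mult.commute Z_def)
    then have "\<alpha> * (2 * Z - 3 * Z\<^sup>2) - 1 = \<alpha> * (Z * (1 - 2 * Z))" by algebra
    also have "\<dots> < 0" using z(8) False \<alpha> by (intro mult_pos_neg) (auto simp: Z_def)
    finally have "\<alpha> * (2 * Z - 3 * Z\<^sup>2) - 1 < 0" .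
    moreover have "((\<lambda>t. \<alpha> * (2 * p t - 3 * (p t)\<^sup>2) - 1) \<longlongrightarrow> \<alpha> * (2 * Z - 3 * Z\<^sup>2) - 1) at_top"
      using p unfolding Z_def by (intro tendsto_intros)
    ultimately have "\<forall>\<^sub>F t in at_top. \<alpha> * (2 * p t - 3 * (p t)\<^sup>2) - 1 < 0"
      by (rule order_tendstoD(2)[rotated])
    then show ?thesis by (rule eventually_mono) simp
  qed
  then obtain T where T: "\<And>t. t \<ge> T \<Longrightarrow> \<alpha> * (2 * p t - 3 * (p t)\<^sup>2) - 1 \<le> 0"
    by (auto simp: eventually_at_top_linorder)
  have "Du \<alpha> (p t) (u t) \<le> 0" if "t \<ge> max 0 T" for t
    using Du_bound[OF _ planar_solutionD(1)[OF sol]] T \<alpha> that by simp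
  then obtain m where m: "(u \<longlongrightarrow> m) at_top" "Du \<alpha> (z_upp \<alpha>) m = 0" "(z_upp \<alpha>, m) \<in> state_space"
    using u_decreasing_limit[OF sol p, of "max 0 T"] by auto
  then show "(u \<longlongrightarrow> 0) at_top" using Du_upp_eq_0[OF \<alpha>] by blast
qed

text \<open>The quadratic factor is positive at 0 because z = \<open>z_mid\<close> is below 1/2, and
  equals - 2 z^2 at z, so it has a root between. The other root lies beyond 1, outside the range of
  u; the bound \<open>b < 2\<close> later serves to estimate the cofactors.\<close>

lemma Du_mid_roots:
  assumes "\<alpha> > 4"
  obtains a b where "0 < a" "a < z_mid \<alpha>" "1 < b" "b < 2"
    "\<And>y. Du \<alpha> (z_mid \<alpha>) y = \<alpha> * y * (y - a) * (y - b)"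
proof -
  have \<alpha>: "\<alpha> \<ge> 4" using assms by simp
  define z where "z = z_mid \<alpha>"
  have z: "0 < z" "z < 1 / 2" and zz: "\<alpha> * (z * (1 - z)) = 1"
    using z_mid_upp(1,7)[OF \<alpha>] z_mid_upp(5,6)[OF \<alpha>] assms
    by (auto simp: z_def) (metis add_diff_cancel_left')
  define f where "f y = y\<^sup>2 - (1 + z) * y + z * (1 - 2 * z)" for y
  have f0: "0 < f 0" using z by (simp add: f_def)
  have fz: "f z < 0"
  proof -
    have "f z = - 2 * z\<^sup>2" by (simp add: f_def power2_eq_square algebra_simps)
    then show ?thesis using z by simp
  qed
  have "\<exists>a\<ge>0. a \<le> z \<and> f a = 0"
    by (rule IVT2') (use f0 fz z in \<open>auto simp: f_def intro!: continuous_intros\<close>)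
  then obtain a where a: "0 \<le> a" "a \<le> z" "f a = 0" by blast
  then have a': "0 < a" "a < z"
    using f0 fz by (metis less_eq_real_def less_irrefl)+
  \<comment> \<open>The roots of the quadratic sum to 1 + z.\<close>
  define b where "b = 1 + z - a"
  have "f y = (y - a) * (y - b)" for y
    using a(3) unfolding f_def b_def by algebra
  then have "Du \<alpha> z y = \<alpha> * y * (y - a) * (y - b)" for y
    using Du_equilibrium[OF zz, of y] by (simp add: f_def)
  with a' z show ?thesis
    by (intro that[of a b]) (auto simp: b_def z_def)
qed

text \<open>With p frozen, the cubic is positive on (0, a) and negative on (a, 1], so a attracts
  every positive start, while a start on the diagonal stays there.\<close>

lemma limit_at_mid:
  assumes \<alpha>: "\<alpha> > 4" and sol: "planar_solution \<alpha> p u" and init: "p 0 = z_mid \<alpha>"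
    and ab: "0 < a" "a < z_mid \<alpha>" "1 < b" "b < 2"
    and Du: "\<And>y. Du \<alpha> (z_mid \<alpha>) y = \<alpha> * y * (y - a) * (y - b)"
  shows "(p \<longlongrightarrow> z_mid \<alpha>) at_top" "u 0 = 0 \<Longrightarrow> (u \<longlongrightarrow> 0) at_top"
    "u 0 > 0 \<Longrightarrow> (u \<longlongrightarrow> a) at_top"
proof -
  have \<alpha>': "\<alpha> \<ge> 4" using \<alpha> by simp
  note z = z_mid_upp[OF \<alpha>']
  have pt: "p t = z_mid \<alpha>" if "t \<ge> 0" for t
    using p_sign(2)[OF \<alpha>' sol that init] .
  show p: "(p \<longlongrightarrow> z_mid \<alpha>) at_top"
    by (rule tendsto_eventually) (use pt in \<open>auto intro: eventually_at_top_linorderI\<close>)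
  have u01: "0 \<le> u t" "u t \<le> 1" if "t \<ge> 0" for t
    using state_space_bounds[OF planar_solutionD(1)[OF sol that]] by auto
  have u': "(u has_real_derivative \<alpha> * u t * (u t - a) * (u t - b)) (at t within {0..})" if "t \<ge> 0" for t
    using planar_solutionD(3)[OF sol that] pt[OF that] Du by simp
  have bd: "\<bar>\<alpha> * (x * y)\<bar> \<le> \<alpha> * 2" if "\<bar>x\<bar> \<le> 1" "\<bar>y\<bar> \<le> 2" for x y
  proof -
    have "\<bar>x\<bar> * \<bar>y\<bar> \<le> 1 * 2" using that by (intro mult_mono) auto
    then show ?thesis using \<alpha> by (simp add: abs_mult)
  qed
  show "(u \<longlongrightarrow> 0) at_top" if "u 0 = 0"
  proof (rule tendsto_eventually)
    have "u t = 0" if "t \<ge> 0" for t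
    proof (rule linear_ode_zero[where x=u and h="\<lambda>t. \<alpha> * ((u t - a) * (u t - b))" and M="\<alpha> * 2"])
      fix s :: real assume s: "s \<ge> 0"
      show "(u has_real_derivative u s * (\<alpha> * ((u s - a) * (u s - b)))) (at s within {0..})"
        using u'[OF s] by (simp add: algebra_simps)
      show "\<bar>\<alpha> * ((u s - a) * (u s - b))\<bar> \<le> \<alpha> * 2"
        by (rule bd) (use u01[OF s] ab z in auto)
    qed (use that \<open>u 0 = 0\<close> in auto)
    then show "\<forall>\<^sub>F t in at_top. u t = 0" by (auto intro: eventually_at_top_linorderI)
  qed
  have D: "((\<lambda>t. u t - a) has_real_derivative (u s - a) * (\<alpha> * (u s * (u s - b)))) (at s within {0..})"
    if "s \<ge> 0" for s
    using u'[OF that] by (auto intro!: derivative_eq_intros simp: algebra_simps)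
  have h: "\<bar>\<alpha> * (u s * (u s - b))\<bar> \<le> \<alpha> * 2" if "s \<ge> 0" for s
    by (rule bd) (use u01[OF that] ab in auto)
  show "(u \<longlongrightarrow> a) at_top" if u0: "u 0 > 0"
  proof -
    have root: "m = a" if "Du \<alpha> (z_mid \<alpha>) m = 0" "(z_mid \<alpha>, m) \<in> state_space" "0 < m" for m
      using that(1,3) state_space_bounds[OF that(2)] ab z \<alpha> unfolding Du by auto
    show ?thesis
    \<comment> \<open>The trajectory stays on its side of a and is monotone. The root 0 is excluded
      by \<open>u 0 \<le> m\<close> from below and by \<open>a \<le> m\<close> from above.\<close>
    proof (cases "u 0 < a")
      case True
      have ua: "u t < a" if "t \<ge> 0" for t
        using linear_ode_neg[OF D h _ that] True by simp
      have "Du \<alpha> (p t) (u t) \<ge> 0" if "t \<ge> 0" for t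
      proof -
        have "0 \<le> (\<alpha> * u t) * ((a - u t) * (b - u t))"
          using u01[OF that] ua[OF that] ab \<alpha> by (intro mult_nonneg_nonneg) auto
        then show ?thesis by (simp add: pt[OF that] Du algebra_simps)
      qed
      then obtain m where "(u \<longlongrightarrow> m) at_top" "Du \<alpha> (z_mid \<alpha>) m = 0" "(z_mid \<alpha>, m) \<in> state_space" "u 0 \<le> m"
        using u_increasing_limit[OF sol p] by blast
      then show ?thesis using root[of m] u0 by simp
    next
      case False
      have ua: "a \<le> u t" if "t \<ge> 0" for t
        using linear_ode_zero[OF D h _ that] linear_ode_pos[OF D h _ that] False by force
      have "Du \<alpha> (p t) (u t) \<le> 0" if "t \<ge> 0" for t
      proof -
        have "0 \<le> (\<alpha> * u t) * ((u t - a) * (b - u t))"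
          using u01[OF that] ua[OF that] ab \<alpha> by (intro mult_nonneg_nonneg) auto
        then show ?thesis by (simp add: pt[OF that] Du algebra_simps)
      qed
      then obtain m where m: "(u \<longlongrightarrow> m) at_top" "Du \<alpha> (z_mid \<alpha>) m = 0" "(z_mid \<alpha>, m) \<in> state_space"
        using u_decreasing_limit[OF sol p, of 0] by blast
      have "a \<le> m"
        by (rule tendsto_lowerbound[OF m(1)]) (auto intro: eventually_at_top_linorderI ua)
      then show ?thesis using root[of m] m ab by simp
    qed
  qed
qed

section \<open>Fixed points and domains of attraction\<close>

lemma fixed_points_iff:
  "\<nu> \<in> fixed_points \<alpha> \<longleftrightarrow> \<nu> \<in> P_sym \<and> Dp \<alpha> (P1 \<nu>) = 0 \<and> Du \<alpha> (P1 \<nu>) (P10 \<nu>) = 0"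
  using mf_rhs_eq_0_iff by (auto simp: fixed_points_def)

lemma P10_eq_0_if_P1_eq_0: "\<mu> \<in> P_sym \<Longrightarrow> P1 \<mu> = 0 \<Longrightarrow> P10 \<mu> = 0"
  using state_space_bounds[OF P_sym_state_space[of \<mu>]] by simp

lemma attraction_low:
  assumes "\<alpha> \<ge> 0" "\<mu>0 \<in> P_sym" "\<alpha> < 4 \<or> \<alpha> \<ge> 4 \<and> P1 \<mu>0 < z_mid \<alpha>"
  shows "\<mu>0 \<in> attraction_domain \<alpha> \<nu>' \<longleftrightarrow> \<nu>' = diag_law nu_low"
proof (rule attraction_domain_iff[OF assms(1,2) diag_law_P_sym])
  have "P1 (diag_law nu_low) = 0" by (simp add: P1_diag_law nu_low_def z_low_def)
  moreover fix p u assume "planar_solution \<alpha> p u" "p 0 = P1 \<mu>0"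
  ultimately show "(p \<longlongrightarrow> P1 (diag_law nu_low)) at_top \<and> (u \<longlongrightarrow> P10 (diag_law nu_low)) at_top"
    using limit_below_mid[of \<alpha> p u] limit_subcritical[of \<alpha> p u] assms by (auto simp: P10_diag_law)
qed

lemma attraction_upp:
  assumes "\<alpha> \<ge> 4" "\<mu>0 \<in> P_sym" "P1 \<mu>0 > z_mid \<alpha> \<or> \<alpha> = 4 \<and> P1 \<mu>0 = z_mid \<alpha>"
  shows "\<mu>0 \<in> attraction_domain \<alpha> \<nu>' \<longleftrightarrow> \<nu>' = diag_law (nu_upp \<alpha>)"
proof (rule attraction_domain_iff[OF _ assms(2) diag_law_P_sym])
  have "P1 (diag_law (nu_upp \<alpha>)) = z_upp \<alpha>"
    using z_mid_upp[OF assms(1)] by (simp add: P1_diag_law nu_upp_def)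
  moreover fix p u assume "planar_solution \<alpha> p u" "p 0 = P1 \<mu>0"
  ultimately show "(p \<longlongrightarrow> P1 (diag_law (nu_upp \<alpha>))) at_top \<and> (u \<longlongrightarrow> P10 (diag_law (nu_upp \<alpha>))) at_top"
    using limit_above_mid[of \<alpha> p u] assms by (auto simp: P10_diag_law)
qed (use assms in simp)

theorem proposition12:
  fixes \<alpha> :: real
  assumes "\<alpha> \<ge> 0"
  shows
    "(\<alpha> > 4 \<longrightarrow>
       (\<exists>\<nu>und.
          fixed_points \<alpha> =
            {diag_law nu_low, \<nu>und, diag_law (nu_mid \<alpha>), diag_law (nu_upp \<alpha>)} \<and>
          card (fixed_points \<alpha>) = 4 \<and>
          (\<forall>\<nu>\<in>fixed_points \<alpha>.
             (\<nu> = diag_law nu_low \<longleftrightarrow> marginal \<nu> = nu_low \<and> on_diagonal \<nu>) \<and>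
             (\<nu> = \<nu>und \<longleftrightarrow> marginal \<nu> = nu_mid \<alpha> \<and> \<not> on_diagonal \<nu>) \<and>
             (\<nu> = diag_law (nu_mid \<alpha>) \<longleftrightarrow> marginal \<nu> = nu_mid \<alpha> \<and> on_diagonal \<nu>) \<and>
             (\<nu> = diag_law (nu_upp \<alpha>) \<longleftrightarrow> marginal \<nu> = nu_upp \<alpha> \<and> on_diagonal \<nu>)) \<and>
          (\<forall>\<mu>0\<in>P_sym. \<exists>\<nu>\<in>fixed_points \<alpha>. \<mu>0 \<in> attraction_domain \<alpha> \<nu>) \<and>
          attraction_domain \<alpha> (diag_law nu_low) =
            {\<mu>0 \<in> P_sym. pmf (marginal \<mu>0) True < z_mid \<alpha>} \<and>
          attraction_domain \<alpha> \<nu>und =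
            {\<mu>0 \<in> P_sym. pmf (marginal \<mu>0) True = z_mid \<alpha> \<and> \<mu>0 \<noteq> diag_law (nu_mid \<alpha>)} \<and>
          attraction_domain \<alpha> (diag_law (nu_mid \<alpha>)) = {diag_law (nu_mid \<alpha>)} \<and>
          attraction_domain \<alpha> (diag_law (nu_upp \<alpha>)) =
            {\<mu>0 \<in> P_sym. pmf (marginal \<mu>0) True > z_mid \<alpha>})) \<and>
     (\<alpha> = 4 \<longrightarrow>
        fixed_points \<alpha> = {diag_law nu_low, diag_law (nu_upp \<alpha>)} \<and>
        card (fixed_points \<alpha>) = 2 \<and>
        attraction_domain \<alpha> (diag_law nu_low) =
          {\<mu>0 \<in> P_sym. pmf (marginal \<mu>0) True < z_mid \<alpha>} \<and>
        attraction_domain \<alpha> (diag_law (nu_upp \<alpha>)) =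
          {\<mu>0 \<in> P_sym. pmf (marginal \<mu>0) True \<ge> z_mid \<alpha>}) \<and>
     (\<alpha> < 4 \<longrightarrow> attraction_domain \<alpha> (diag_law nu_low) = P_sym)"
proof (intro conjI impI)
  have low: "\<nu> = diag_law nu_low \<longleftrightarrow> P1 \<nu> = 0 \<and> P10 \<nu> = 0"
    "marginal \<nu> = nu_low \<longleftrightarrow> P1 \<nu> = 0" if "\<nu> \<in> P_sym" for \<nu>
    using eq_diag_law_iff[OF that, of 0] marginal_bernoulli_iff[of 0 \<nu>] by (simp_all add: nu_low_def z_low_def)
  have mid: "\<nu> = diag_law (nu_mid \<alpha>) \<longleftrightarrow> P1 \<nu> = z_mid \<alpha> \<and> P10 \<nu> = 0"
    "marginal \<nu> = nu_mid \<alpha> \<longleftrightarrow> P1 \<nu> = z_mid \<alpha>" if "\<nu> \<in> P_sym" "\<alpha> \<ge> 4" for \<nu>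
    using eq_diag_law_iff[OF that(1), of "z_mid \<alpha>"] marginal_bernoulli_iff[of "z_mid \<alpha>" \<nu>] z_mid_upp[OF that(2)]
    by (simp_all add: nu_mid_def)
  have upp: "\<nu> = diag_law (nu_upp \<alpha>) \<longleftrightarrow> P1 \<nu> = z_upp \<alpha> \<and> P10 \<nu> = 0"
    "marginal \<nu> = nu_upp \<alpha> \<longleftrightarrow> P1 \<nu> = z_upp \<alpha>" if "\<nu> \<in> P_sym" "\<alpha> \<ge> 4" for \<nu>
    using eq_diag_law_iff[OF that(1), of "z_upp \<alpha>"] marginal_bernoulli_iff[of "z_upp \<alpha>" \<nu>] z_mid_upp[OF that(2)]
    by (simp_all add: nu_upp_def)
  have dom_sym: "attraction_domain \<alpha> \<nu> \<subseteq> P_sym" for \<nu>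
    by (auto simp: attraction_domain_def)
  have P10_upp: "P10 \<nu> = 0" if "\<nu> \<in> fixed_points \<alpha>" "P1 \<nu> = z_upp \<alpha>" "\<alpha> \<ge> 4" for \<nu>
    using Du_upp_eq_0[OF that(3), of "P10 \<nu>"] P_sym_state_space[of \<nu>] that by (auto simp: fixed_points_iff)
  {
    assume \<alpha>: "\<alpha> > 4"
    then have \<alpha>': "\<alpha> \<ge> 4" by simp
    note z = z_mid_upp[OF \<alpha>']
    obtain a b where ab: "0 < a" "a < z_mid \<alpha>" "1 < b" "b < 2"
      and Du: "\<And>y. Du \<alpha> (z_mid \<alpha>) y = \<alpha> * y * (y - a) * (y - b)"
      using Du_mid_roots[OF \<alpha>] by blast
    have "(z_mid \<alpha>, a) \<in> state_space" using ab z by (auto simp: state_space_def)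
    then obtain \<nu>und where und: "\<nu>und \<in> P_sym" "P1 \<nu>und = z_mid \<alpha>" "P10 \<nu>und = a"
      by (rule state_space_P_sym)
    have und_eq: "\<nu> = \<nu>und \<longleftrightarrow> P1 \<nu> = z_mid \<alpha> \<and> P10 \<nu> = a" if "\<nu> \<in> P_sym" for \<nu>
      using P_sym_eqI[OF that und(1)] und by auto
    \<comment> \<open>The third root b is discarded because it exceeds 1.\<close>
    have P10_mid: "P10 \<nu> = 0 \<or> P10 \<nu> = a" if "\<nu> \<in> fixed_points \<alpha>" "P1 \<nu> = z_mid \<alpha>" for \<nu>
      using that Du[of "P10 \<nu>"] state_space_bounds(6)[OF P_sym_state_space[of \<nu>]] ab \<alpha>
      by (auto simp: fixed_points_iff)
    have fp: "fixed_points \<alpha> = {diag_law nu_low, \<nu>und, diag_law (nu_mid \<alpha>), diag_law (nu_upp \<alpha>)}"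
    proof (intro equalityI subsetI)
      fix \<nu> assume \<nu>: "\<nu> \<in> fixed_points \<alpha>"
      then have "\<nu> \<in> P_sym" "P1 \<nu> = 0 \<or> P1 \<nu> = z_mid \<alpha> \<or> P1 \<nu> = z_upp \<alpha>"
        by (auto simp: fixed_points_iff Dp_eq_0_iff[OF \<alpha>'])
      then show "\<nu> \<in> {diag_law nu_low, \<nu>und, diag_law (nu_mid \<alpha>), diag_law (nu_upp \<alpha>)}"
        using P10_eq_0_if_P1_eq_0[of \<nu>] P10_mid[OF \<nu>] P10_upp[OF \<nu>] \<alpha>'
          low(1)[of \<nu>] mid(1)[of \<nu>] upp(1)[of \<nu>] und_eq[of \<nu>] by auto
    next
      fix \<nu> assume "\<nu> \<in> {diag_law nu_low, \<nu>und, diag_law (nu_mid \<alpha>), diag_law (nu_upp \<alpha>)}"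
      then show "\<nu> \<in> fixed_points \<alpha>"
        using low(1)[OF diag_law_P_sym, of nu_low] mid(1)[OF diag_law_P_sym \<alpha>', of "nu_mid \<alpha>"]
          upp(1)[OF diag_law_P_sym \<alpha>', of "nu_upp \<alpha>"] und
        by (auto simp: fixed_points_iff diag_law_P_sym Dp_eq_0_iff[OF \<alpha>'] Du) (auto simp: Du_def)
    qed
    have dist: "diag_law nu_low \<noteq> \<nu>und" "diag_law nu_low \<noteq> diag_law (nu_mid \<alpha>)"
      "diag_law nu_low \<noteq> diag_law (nu_upp \<alpha>)" "\<nu>und \<noteq> diag_law (nu_mid \<alpha>)"
      "\<nu>und \<noteq> diag_law (nu_upp \<alpha>)" "diag_law (nu_mid \<alpha>) \<noteq> diag_law (nu_upp \<alpha>)"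
      using low(1)[OF diag_law_P_sym, of nu_low] mid(1)[OF diag_law_P_sym \<alpha>', of "nu_mid \<alpha>"]
        upp(1)[OF diag_law_P_sym \<alpha>', of "nu_upp \<alpha>"] und z \<alpha> ab by auto
    have card: "card (fixed_points \<alpha>) = 4"
      unfolding fp using dist by simp
    have char: "(\<nu> = diag_law nu_low \<longleftrightarrow> marginal \<nu> = nu_low \<and> on_diagonal \<nu>) \<and>
             (\<nu> = \<nu>und \<longleftrightarrow> marginal \<nu> = nu_mid \<alpha> \<and> \<not> on_diagonal \<nu>) \<and>
             (\<nu> = diag_law (nu_mid \<alpha>) \<longleftrightarrow> marginal \<nu> = nu_mid \<alpha> \<and> on_diagonal \<nu>) \<and>
             (\<nu> = diag_law (nu_upp \<alpha>) \<longleftrightarrow> marginal \<nu> = nu_upp \<alpha> \<and> on_diagonal \<nu>)"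
      if \<nu>: "\<nu> \<in> fixed_points \<alpha>" for \<nu>
    proof -
      have s: "\<nu> \<in> P_sym" using \<nu> by (simp add: fixed_points_iff)
      show ?thesis
        unfolding low[OF s] mid[OF s \<alpha>'] upp[OF s \<alpha>'] und_eq[OF s] on_diagonal_iff[OF s]
        using P10_mid[OF \<nu>] ab by auto
    qed
    have dom_low: "\<mu>0 \<in> attraction_domain \<alpha> \<nu> \<longleftrightarrow> \<nu> = diag_law nu_low"
      if "\<mu>0 \<in> P_sym" "P1 \<mu>0 < z_mid \<alpha>" for \<mu>0 \<nu>
      using attraction_low that assms \<alpha>' by blast
    have dom_upp: "\<mu>0 \<in> attraction_domain \<alpha> \<nu> \<longleftrightarrow> \<nu> = diag_law (nu_upp \<alpha>)"
      if "\<mu>0 \<in> P_sym" "z_mid \<alpha> < P1 \<mu>0" for \<mu>0 \<nu>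
      using attraction_upp that \<alpha>' by blast
    have dom_mid: "\<mu>0 \<in> attraction_domain \<alpha> \<nu> \<longleftrightarrow> \<nu> = diag_law (nu_mid \<alpha>)"
      if "\<mu>0 = diag_law (nu_mid \<alpha>)" for \<mu>0 \<nu>
    proof (rule attraction_domain_iff[OF assms])
      fix p u assume "planar_solution \<alpha> p u" "p 0 = P1 \<mu>0" "u 0 = P10 \<mu>0"
      then show "(p \<longlongrightarrow> P1 (diag_law (nu_mid \<alpha>))) at_top \<and> (u \<longlongrightarrow> P10 (diag_law (nu_mid \<alpha>))) at_top"
        using limit_at_mid[OF \<alpha> _ _ ab Du, of p u] mid(1)[OF diag_law_P_sym \<alpha>', of "nu_mid \<alpha>"] that by auto
    qed (auto simp: that diag_law_P_sym)
    have dom_und: "\<mu>0 \<in> attraction_domain \<alpha> \<nu> \<longleftrightarrow> \<nu> = \<nu>und"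
      if "\<mu>0 \<in> P_sym" "P1 \<mu>0 = z_mid \<alpha>" "\<mu>0 \<noteq> diag_law (nu_mid \<alpha>)" for \<mu>0 \<nu>
    proof (rule attraction_domain_iff[OF assms that(1) und(1)])
      have "P10 \<mu>0 > 0"
        using mid(1)[OF that(1) \<alpha>'] that state_space_bounds(1)[OF P_sym_state_space[OF that(1)]] by auto
      moreover fix p u assume "planar_solution \<alpha> p u" "p 0 = P1 \<mu>0" "u 0 = P10 \<mu>0"
      ultimately show "(p \<longlongrightarrow> P1 \<nu>und) at_top \<and> (u \<longlongrightarrow> P10 \<nu>und) at_top"
        using limit_at_mid[OF \<alpha> _ _ ab Du, of p u] that und by auto
    qed
    \<comment> \<open>The right-hand side is the limit as a function of the initial law. The domains
      are its fibres, and \<open>dist\<close> separates them.\<close>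
    have cases: "(\<mu>0 \<in> attraction_domain \<alpha> \<nu>) \<longleftrightarrow> \<nu> =
        (if P1 \<mu>0 < z_mid \<alpha> then diag_law nu_low else if z_mid \<alpha> < P1 \<mu>0 then diag_law (nu_upp \<alpha>)
         else if \<mu>0 = diag_law (nu_mid \<alpha>) then diag_law (nu_mid \<alpha>) else \<nu>und)"
      if "\<mu>0 \<in> P_sym" for \<mu>0 \<nu>
      using dom_low[OF that] dom_upp[OF that] dom_mid[of \<mu>0] dom_und[OF that] by auto
    have P1_mid: "P1 (diag_law (nu_mid \<alpha>)) = z_mid \<alpha>"
      using mid(1)[OF diag_law_P_sym \<alpha>', of "nu_mid \<alpha>"] by simp
    have conv: "\<forall>\<mu>0\<in>P_sym. \<exists>\<nu>\<in>fixed_points \<alpha>. \<mu>0 \<in> attraction_domain \<alpha> \<nu>"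
      unfolding fp using cases by auto
    have dom: "attraction_domain \<alpha> \<nu> = {\<mu>0 \<in> P_sym. \<nu> =
        (if P1 \<mu>0 < z_mid \<alpha> then diag_law nu_low else if z_mid \<alpha> < P1 \<mu>0 then diag_law (nu_upp \<alpha>)
         else if \<mu>0 = diag_law (nu_mid \<alpha>) then diag_law (nu_mid \<alpha>) else \<nu>und)}" for \<nu>
      using cases dom_sym[of \<nu>] by blast
    have D1: "attraction_domain \<alpha> (diag_law nu_low) = {\<mu>0 \<in> P_sym. pmf (marginal \<mu>0) True < z_mid \<alpha>}"
      unfolding dom P1_marginal using dist by (intro Collect_cong) auto
    have D2: "attraction_domain \<alpha> \<nu>und =
        {\<mu>0 \<in> P_sym. pmf (marginal \<mu>0) True = z_mid \<alpha> \<and> \<mu>0 \<noteq> diag_law (nu_mid \<alpha>)}"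
      unfolding dom P1_marginal using dist by (intro Collect_cong) auto
    have D3: "attraction_domain \<alpha> (diag_law (nu_mid \<alpha>)) = {diag_law (nu_mid \<alpha>)}"
      unfolding dom using dist P1_mid diag_law_P_sym by (auto split: if_splits)
    have D4: "attraction_domain \<alpha> (diag_law (nu_upp \<alpha>)) = {\<mu>0 \<in> P_sym. pmf (marginal \<mu>0) True > z_mid \<alpha>}"
      unfolding dom P1_marginal using dist by (intro Collect_cong) auto
    show "\<exists>\<nu>und.
          fixed_points \<alpha> =
            {diag_law nu_low, \<nu>und, diag_law (nu_mid \<alpha>), diag_law (nu_upp \<alpha>)} \<and>
          card (fixed_points \<alpha>) = 4 \<and>
          (\<forall>\<nu>\<in>fixed_points \<alpha>.
             (\<nu> = diag_law nu_low \<longleftrightarrow> marginal \<nu> = nu_low \<and> on_diagonal \<nu>) \<and>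
             (\<nu> = \<nu>und \<longleftrightarrow> marginal \<nu> = nu_mid \<alpha> \<and> \<not> on_diagonal \<nu>) \<and>
             (\<nu> = diag_law (nu_mid \<alpha>) \<longleftrightarrow> marginal \<nu> = nu_mid \<alpha> \<and> on_diagonal \<nu>) \<and>
             (\<nu> = diag_law (nu_upp \<alpha>) \<longleftrightarrow> marginal \<nu> = nu_upp \<alpha> \<and> on_diagonal \<nu>)) \<and>
          (\<forall>\<mu>0\<in>P_sym. \<exists>\<nu>\<in>fixed_points \<alpha>. \<mu>0 \<in> attraction_domain \<alpha> \<nu>) \<and>
          attraction_domain \<alpha> (diag_law nu_low) =
            {\<mu>0 \<in> P_sym. pmf (marginal \<mu>0) True < z_mid \<alpha>} \<and>
          attraction_domain \<alpha> \<nu>und =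
            {\<mu>0 \<in> P_sym. pmf (marginal \<mu>0) True = z_mid \<alpha> \<and> \<mu>0 \<noteq> diag_law (nu_mid \<alpha>)} \<and>
          attraction_domain \<alpha> (diag_law (nu_mid \<alpha>)) = {diag_law (nu_mid \<alpha>)} \<and>
          attraction_domain \<alpha> (diag_law (nu_upp \<alpha>)) =
            {\<mu>0 \<in> P_sym. pmf (marginal \<mu>0) True > z_mid \<alpha>}"
      by (intro exI[of _ \<nu>und] conjI fp card ballI[OF char] conv D1 D2 D3 D4)
  next
    assume \<alpha>: "\<alpha> = 4"
    then have \<alpha>': "\<alpha> \<ge> 4" by simp
    note z = z_mid_upp[OF \<alpha>']
    have dist: "diag_law nu_low \<noteq> diag_law (nu_upp \<alpha>)"
      using low(1)[OF diag_law_P_sym, of nu_low] upp(1)[OF diag_law_P_sym \<alpha>', of "nu_upp \<alpha>"] z by auto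
    show fp: "fixed_points \<alpha> = {diag_law nu_low, diag_law (nu_upp \<alpha>)}"
    proof (intro equalityI subsetI)
      fix \<nu> assume \<nu>: "\<nu> \<in> fixed_points \<alpha>"
      then have "\<nu> \<in> P_sym" "P1 \<nu> = 0 \<or> P1 \<nu> = z_upp \<alpha>"
        using z(9,10)[OF \<alpha>] by (auto simp: fixed_points_iff Dp_eq_0_iff[OF \<alpha>'])
      then show "\<nu> \<in> {diag_law nu_low, diag_law (nu_upp \<alpha>)}"
        using P10_eq_0_if_P1_eq_0[of \<nu>] P10_upp[OF \<nu>] \<alpha>' low(1)[of \<nu>] upp(1)[of \<nu>] by auto
    next
      fix \<nu> assume "\<nu> \<in> {diag_law nu_low, diag_law (nu_upp \<alpha>)}"
      then show "\<nu> \<in> fixed_points \<alpha>"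
        using low(1)[OF diag_law_P_sym, of nu_low] upp(1)[OF diag_law_P_sym \<alpha>', of "nu_upp \<alpha>"]
        by (auto simp: fixed_points_iff diag_law_P_sym Dp_eq_0_iff[OF \<alpha>'] Du_def)
    qed
    show "card (fixed_points \<alpha>) = 2" unfolding fp using dist by simp
    \<comment> \<open>The threshold itself now belongs to the upper domain, because
      \<open>z_mid\<close> coincides with \<open>z_upp\<close>.\<close>
    have cases: "(\<mu>0 \<in> attraction_domain \<alpha> \<nu>) \<longleftrightarrow> \<nu> =
        (if P1 \<mu>0 < z_mid \<alpha> then diag_law nu_low else diag_law (nu_upp \<alpha>))"
      if "\<mu>0 \<in> P_sym" for \<mu>0 \<nu>
      using attraction_low[OF assms that, of \<nu>] attraction_upp[OF \<alpha>' that, of \<nu>] \<alpha>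
      by (cases "P1 \<mu>0 < z_mid \<alpha>") (auto simp: not_less_iff_gr_or_eq)
    have dom: "attraction_domain \<alpha> \<nu> = {\<mu>0 \<in> P_sym. \<nu> =
        (if P1 \<mu>0 < z_mid \<alpha> then diag_law nu_low else diag_law (nu_upp \<alpha>))}" for \<nu>
      using cases dom_sym[of \<nu>] by blast
    show "attraction_domain \<alpha> (diag_law nu_low) = {\<mu>0 \<in> P_sym. pmf (marginal \<mu>0) True < z_mid \<alpha>}"
      unfolding dom P1_marginal using dist by (intro Collect_cong) auto
    show "attraction_domain \<alpha> (diag_law (nu_upp \<alpha>)) = {\<mu>0 \<in> P_sym. pmf (marginal \<mu>0) True \<ge> z_mid \<alpha>}"
      unfolding dom P1_marginal using dist by (intro Collect_cong) auto
  next
    assume "\<alpha> < 4"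
    then show "attraction_domain \<alpha> (diag_law nu_low) = P_sym"
      using attraction_low[OF assms] dom_sym[of "diag_law nu_low"] by blast
  }
qed

end
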